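(* Let $B$ be an interpolating Blaschke product with zeros $\{a_j\}_{j\in\mathbb N}$. (a) We have $\ell^1\subset K^\infty_B\big|_{\{a_j\}}$; that is, for every complex sequence $\{w_j\}_{j\in\mathbb N}$ with $\sum_j|w_j|<\infty$ there exists $f\in K^\infty_B$ with $f(a_j)=w_j$ for all $j\in\mathbb N$. (b) If $0\le a_1<a_2<\dots<1$, and if $X$ is an ideal sequence space with $X\subset K^\infty_B\big|_{\{a_j\}}$, then $X\subset\ell^1$.
   Context: $\mathbb D$ is the open unit disk in $\mathbb C$, $\mathbb T$ its boundary, and $m$ normalized arclength measure on $\mathbb T$. $H^\infty$ is the space of bounded holomorphic functions on $\mathbb D$, identified with their boundary functions (defined a.e. on $\mathbb T$), and $H^\infty_0=\{f\in H^\infty: f(0)=0\}$. Given a sequence $\{a_j\}_{j\in\mathbb N}$ in $\mathbb D$ with $\sum_j(1-|a_j|)<\infty$, the associated Blaschke product is $$B(z)=\prod_j b_j(z),\qquad b_j(z)=\frac{|a_j|}{a_j}\,\frac{a_j-z}{1-\overline{a_j}z},$$ with the convention $|a_j|/a_j=-1$ if $a_j=0$. $B$ is called an interpolating Blaschke product (with zeros $\{a_j\}$) if $\inf_j|B'(a_j)|\,(1-|a_j|)>0$. The star-invariant subspace $K^\infty_B$ is $K^\infty_B:=H^\infty\cap B\,\overline{H^\infty_0}$, i.e. the set of $f\in H^\infty$ for which there is $g\in H^\infty_0$ with $f=B\overline g$ a.e. on $\mathbb T$. For a function space $\mathcal X$ on $\mathbb D$, $\mathcal X\big|_{\{a_j\}}$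 denotes the set of complex sequences $\{w_j\}$ for which there is $f\in\mathcal X$ with $f(a_j)=w_j$ for all $j\in\mathbb N$. A vector space $S$ consisting of sequences of complex numbers (indexed by $\mathbb N$) is called ideal (an ideal sequence space) if, whenever $\{x_j\}\in S$ and $\{y_j\}$ is a complex sequence with $|y_j|\le|x_j|$ for all $j$, one has $\{y_j\}\in S$. *)

theory Defs
  imports "HOL-Complex_Analysis.Complex_Analysis"
begin

definition arclength :: "complex measure" where
  "arclength = distr (uniform_measure lborel {0..<2 * pi}) borel cis"

text \<open>
  Functions on the open disk are represented by total functions on the complex plane; only their
  values on \<^term>\<open>ball (0::complex) 1\<close> matter. In particular the boundary function is not the
  restriction to the unit circle but the radial limit, which for members of \<open>H_inf\<close> exists
  almost everywhere by Fatou's theorem.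
\<close>

definition H_inf :: "(complex \<Rightarrow> complex) set" where
  "H_inf = {f. f holomorphic_on ball 0 1 \<and> bounded (f ` ball 0 1)}"

definition H_inf_0 :: "(complex \<Rightarrow> complex) set" where
  "H_inf_0 = {f \<in> H_inf. f 0 = 0}"

definition boundary_fun :: "(complex \<Rightarrow> complex) \<Rightarrow> complex \<Rightarrow> complex" where
  "boundary_fun f \<zeta> = Lim (at_left 1) (\<lambda>r::real. f (of_real r * \<zeta>))"

definition blaschke_factor :: "complex \<Rightarrow> complex \<Rightarrow> complex" where
  "blaschke_factor c z =
     (if c = 0 then -1 else of_real (norm c) / c) * ((c - z) / (1 - cnj c * z))"

definition blaschke_product :: "(nat \<Rightarrow> complex) \<Rightarrow> complex \<Rightarrow> complex" where
  "blaschke_product a z = (\<Prod>j. blaschke_factor (a j) z)"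

definition interpolating_blaschke :: "(nat \<Rightarrow> complex) \<Rightarrow> bool" where
  "interpolating_blaschke a \<longleftrightarrow>
     range a \<subseteq> ball 0 1 \<and> summable (\<lambda>j. 1 - norm (a j)) \<and>
     (INF j. norm (deriv (blaschke_product a) (a j)) * (1 - norm (a j))) > 0"

definition K_inf :: "(complex \<Rightarrow> complex) \<Rightarrow> (complex \<Rightarrow> complex) set" where
  "K_inf B = {f \<in> H_inf. \<exists>g\<in>H_inf_0.
     AE \<zeta> in arclength. boundary_fun f \<zeta> = boundary_fun B \<zeta> * cnj (boundary_fun g \<zeta>)}"

definition sequence_trace ::
  "(complex \<Rightarrow> complex) set \<Rightarrow> (nat \<Rightarrow> complex) \<Rightarrow> (nat \<Rightarrow> complex) set" where
  "sequence_trace F a = {w. \<exists>f\<in>F. \<forall>j. f (a j) = w j}"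

definition ell1 :: "(nat \<Rightarrow> complex) set" where
  "ell1 = {w. summable (\<lambda>j. norm (w j))}"

definition ideal_sequence_space :: "(nat \<Rightarrow> complex) set \<Rightarrow> bool" where
  "ideal_sequence_space S \<longleftrightarrow>
     (\<lambda>_. 0) \<in> S \<and>
     (\<forall>x\<in>S. \<forall>y\<in>S. (\<lambda>j. x j + y j) \<in> S) \<and>
     (\<forall>c. \<forall>x\<in>S. (\<lambda>j. c * x j) \<in> S) \<and>
     (\<forall>x\<in>S. \<forall>y. (\<forall>j. norm (y j) \<le> norm (x j)) \<longrightarrow> y \<in> S)"

end

theory Submission
  imports Defs
begin

text \<open>
  (a) On the circle, \<open>B/(B'(a\<^sub>j)(z - a\<^sub>j))\<close> is \<open>B\<close> times the conjugate of
  \<open>z/(cnj (B'(a\<^sub>j)) (1 - cnj a\<^sub>j z))\<close>, because \<open>|B| = 1\<close> almost everywhere. Both functions are bounded on the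
  disk by \<open>1/\<delta>\<close> where \<open>\<delta> = inf |B'(a\<^sub>j)| (1 - |a\<^sub>j|)\<close>, so for \<open>w \<in> \<ell>\<^sup>1\<close> the series of the former with
  coefficients \<open>w\<^sub>j\<close> interpolates \<open>w\<close> and lies in \<open>K\<^sub>B\<close>.

  (b) If \<open>f = B cnj g\<close> on the circle, then \<open>cnj (g(cnj z)) = \<Sum> f(a\<^sub>j) z/(B'(a\<^sub>j)(1 - a\<^sub>j z))\<close>. Since \<open>X\<close> is ideal, the
  phases of \<open>f(a\<^sub>j)\<close> may be chosen so that all terms are nonnegative when \<open>z = a\<^sub>k\<close>. By the Schwarz-Pick bound
  \<open>|B'(a\<^sub>j)| (1 - a\<^sub>j\<^sup>2) \<le> 1\<close> the terms with \<open>j < k\<close> are at least \<open>a\<^sub>1 |f(a\<^sub>j)|\<close> (zeros indexed from \<open>0\<close>), so the partial sums of \<open>|f(a\<^sub>j)|\<close>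
  stay bounded by a multiple of the supremum of \<open>|g|\<close>.

  Both parts rest on Fatou's theorem: the maximal function of the dilates of \<open>f\<close> satisfies a weak-type
  inequality by Vitali covering, and \<open>f(R z) - f(s R z)\<close> is small in mean, uniformly in \<open>R\<close>, by Parseval.
\<close>

section \<open>Fatou's theorem\<close>

text \<open>\<open>boundary_fun\<close> is a \<open>Lim\<close>, an unspecified value wherever the
  radial limit fails to exist, so existence almost everywhere has to be settled before membership in
  \<open>K_inf\<close> can be used. The argument stays inside holomorphic functions: a Cauchy
  integral of a primitive takes the place of the Poisson kernel when radial values are bounded by
  circle averages. In (a) the uniform bound comes from an exact cancellation: dividing
  \<open>B\<close> by \<open>z - a j\<close> costs at most \<open>1/(1 - |a j|)\<close>, and the
  interpolation condition repays just this factor. In (b) the obstacle is that the zeros of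
  \<open>B\<close> accumulate at the circle, so residues of a quotient by \<open>B\<close> cannot be
  collected on circles close to it with a bounded integrand. A finite product is bounded away from 0
  near the circle, hence the detour through partial products. The order of the zeros enters once:
  for \<open>j < k\<close>, \<open>a j <= a k\<close> gives
  \<open>1 - a j * a k <= 1 - (a j)^2\<close>, which brings the denominators within reach of
  Schwarz-Pick. The lower bound uses the second zero because the first may be 0.\<close>

lemma maximal_function_weak_type:
  fixes h :: "real \<Rightarrow> real"
  assumes cont: "continuous_on UNIV h" and nonneg: "\<And>x. 0 \<le> h x" and l: "0 < l"
    and E: "E \<in> lmeasurable" "E \<subseteq> {a..b}"
    and ex: "\<And>x. x \<in> E \<Longrightarrow> \<exists>s. 0 < s \<and> s \<le> D \<and> l * s < integral {x-s..x+s} h"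
  shows "measure lebesgue E \<le> 10 / l * integral {a-D..b+D} h"
proof -
  obtain r where r: "\<And>x. x \<in> E \<Longrightarrow> 0 < r x \<and> r x \<le> D \<and> l * r x < integral {x - r x..x + r x} h"
    using ex by metis
  have int: "h integrable_on {c..d}" for c d
    using cont continuous_on_subset integrable_continuous_real by blast
  obtain C where C: "countable C" "C \<subseteq> E"
     "pairwise (\<lambda>i j. disjnt (cball i (r i)) (cball j (r j))) C"
     "E \<subseteq> (\<Union>i\<in>C. cball i (5 * r i))"
  proof (rule Vitali_covering_lemma_cballs[where S=E and K=E and a="\<lambda>x. x" and r=r and B=D])
    show "E \<subseteq> (\<Union>i\<in>E. cball i (r i))"
      using r by (force simp: less_imp_le)
  qed (use r in auto)
  define I where "I = integral {a-D..b+D} h"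
  have I0: "0 \<le> I" unfolding I_def by (simp add: integral_nonneg int nonneg)
  \<comment> \<open>A bound on finite subfamilies that does not depend on \<open>F\<close> passes to
    the countable Vitali cover. The 10 is the length of an interval of radius \<open>5 * r i\<close>
    in units of \<open>r i\<close>, and \<open>l * r i\<close> is below the integral over the
    undilated interval; these intervals are disjoint.\<close>
  have fin: "measure lebesgue (\<Union>i\<in>F. cball i (5 * r i)) \<le> 10 / l * I" if F: "F \<subseteq> C" "finite F" for F
  proof -
    have rF: "0 < r i" "r i \<le> D" "l * r i < integral {i - r i..i + r i} h" "i \<in> {a..b}" if "i \<in> F" for i
      using r F(1) C(2) E(2) that by blast+
    have hi: "(h has_integral (\<Sum>i\<in>F. integral (cball i (r i)) h)) (\<Union>i\<in>F. cball i (r i))"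
    proof (rule has_integral_UN[OF F(2)])
      show "(h has_integral integral (cball i (r i)) h) (cball i (r i))" if "i \<in> F" for i
        by (simp add: cball_eq_atLeastAtMost int integrable_integral)
      show "pairwise (\<lambda>i i'. negligible (cball i (r i) \<inter> cball i' (r i'))) F"
        using C(3) F(1) by (auto simp: pairwise_def disjnt_def subset_iff)
    qed
    have "measure lebesgue (\<Union>i\<in>F. cball i (5 * r i)) \<le> (\<Sum>i\<in>F. measure lebesgue (cball i (5 * r i)))"
      by (intro measure_UNION_le F) auto
    also have "\<dots> = (\<Sum>i\<in>F. 10 * r i)"
      using rF by (intro sum.cong) (auto simp: cball_eq_atLeastAtMost less_imp_le)
    also have "\<dots> \<le> (\<Sum>i\<in>F. 10 / l * integral (cball i (r i)) h)"
    proof (rule sum_mono)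
      fix i assume "i \<in> F"
      from rF[OF this] show "10 * r i \<le> 10 / l * integral (cball i (r i)) h"
        using l by (simp add: cball_eq_atLeastAtMost field_simps)
    qed
    also have "\<dots> = 10 / l * (\<Sum>i\<in>F. integral (cball i (r i)) h)"
      by (simp add: sum_distrib_left)
    also have "(\<Sum>i\<in>F. integral (cball i (r i)) h) = integral (\<Union>i\<in>F. cball i (r i)) h"
      using hi by (rule integral_unique[symmetric])
    also have "integral (\<Union>i\<in>F. cball i (r i)) h \<le> I"
      unfolding I_def
    proof (rule integral_subset_le)
      show "(\<Union>i\<in>F. cball i (r i)) \<subseteq> {a-D..b+D}"
        using rF by (force simp: cball_eq_atLeastAtMost)
      show "h integrable_on (\<Union>i\<in>F. cball i (r i))"
        using hi by blast
    qed (auto simp: int nonneg)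
    finally show ?thesis
      using l by (simp add: mult_left_mono divide_right_mono)
  qed
  have m: "cball i (5 * r i) \<in> lmeasurable" for i by simp
  have "measure lebesgue E \<le> measure lebesgue (\<Union>i\<in>C. cball i (5 * r i))"
    by (rule measure_mono_fmeasurable[OF C(4) fmeasurableD[OF E(1)]
        fmeasurable_UN_bound[OF C(1) m fin]])
  also have "\<dots> \<le> 10 / l * I"
    by (rule measure_UN_bound[OF C(1) m fin])
  finally show ?thesis by (simp add: I_def)
qed

section \<open>Pointwise bounds from circle averages\<close>

lemma sin_ge_third: 
  fixes y :: real assumes "\<bar>y\<bar> \<le> 2" shows "\<bar>y\<bar> / 3 \<le> \<bar>sin y\<bar>"
proof -
  have "\<bar>sin y - y\<bar> \<le> \<bar>y\<bar>^3 / 6"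
    using Maclaurin_sin_bound[of y 3] by (simp add: sin_coeff_def eval_nat_numeral)
  also have "\<dots> \<le> \<bar>y\<bar> * 4 / 6"
    using assms power_mono[of "\<bar>y\<bar>" 2 2] mult_left_mono[of "\<bar>y\<bar>^2" 4 "\<bar>y\<bar>"]
    by (simp add: power2_eq_square power3_eq_cube mult.assoc)
  finally show ?thesis by linarith
qed

text \<open>The right-hand side equals \<open>(1 - r)^2 + 4 * r * (sin ((t - pi) / 2))^2\<close>.
  Since \<open>2 * r >= 1\<close>, \<open>sin_ge_third\<close> at \<open>(t - pi) / 2\<close> makes
  the second summand at least \<open>(t - pi)^2 / 18\<close>.\<close>

lemma norm_cis_add_ge:
  fixes r t :: real
  assumes r: "1/2 \<le> r" "r < 1" and t: "0 \<le> t" "t \<le> 2 * pi"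
  shows "((1 - r)\<^sup>2 + (t - pi)\<^sup>2) / 18 \<le> (norm (cis t + of_real r))\<^sup>2"
proof -
  define y where "y = (t - pi) / 2"
  have y: "\<bar>y\<bar> \<le> 2" using t pi_less_4 by (auto simp: y_def)
  have "2 * y = t - pi" by (simp add: y_def)
  then have "cos t = - cos (2 * y)"
    by (simp only: cos_diff) simp
  then have c: "1 + cos t = 2 * (sin y)\<^sup>2"
    by (simp add: cos_double_sin)
  have "(\<bar>y\<bar> / 3)\<^sup>2 \<le> \<bar>sin y\<bar>\<^sup>2"
    by (intro power_mono sin_ge_third y) auto
  then have s: "y\<^sup>2 / 9 \<le> (sin y)\<^sup>2" by (simp add: power_divide)
  have n: "(norm (cis t + of_real r))\<^sup>2 = (1 - r)\<^sup>2 + 2 * r * (1 + cos t)"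
  proof -
    have "(norm (cis t + of_real r))\<^sup>2 = (cos t + r)\<^sup>2 + (sin t)\<^sup>2" by (simp add: cmod_power2)
    also have "\<dots> = (1 - r)\<^sup>2 + 2 * r * (1 + cos t)"
      using sin_cos_squared_add[of t] by (simp add: power2_eq_square algebra_simps)
    finally show ?thesis .
  qed
  have "1 * (2 * (y\<^sup>2 / 9)) \<le> 2 * r * (1 + cos t)"
    unfolding c using s r by (intro mult_mono) auto
  then have "(1 - r)\<^sup>2 + 2 * y\<^sup>2 / 9 \<le> (norm (cis t + of_real r))\<^sup>2"
    by (simp add: n)
  moreover have "(t - pi)\<^sup>2 = 4 * y\<^sup>2" by (simp add: y_def power_divide)
  moreover have "(0::real) \<le> (1 - r)\<^sup>2" by simp
  ultimately show ?thesis unfolding add_divide_distrib by linarith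
qed

text \<open>\<open>-1/r\<close> is the reflection of \<open>-r\<close> in the unit circle, so on the
  circle \<open>|z + 1/r| = |z + r| / r\<close>. In the difference of the two fractions one
  numerator factor is then comparable to \<open>|z + r|\<close>, and the other is the distance of
  the poles, of order \<open>1 - r\<close>.\<close>

lemma norm_kernel_le:
  fixes z :: complex and r :: real
  assumes z: "norm z = 1" and r: "0 < r" "r < 1"
  shows "norm (1 / (z + of_real r)\<^sup>2 - 1 / (z + of_real (1/r))\<^sup>2) \<le> 4 * (1 - r) / norm (z + of_real r) ^ 3"
proof -
  define A B where "A = z + of_real r" and "B = z + of_real (1/r)"
  have zz: "z * cnj z = 1" using z by (simp add: complex_norm_square[symmetric])
  have "r * norm B = norm (of_real r * z + 1)"
    using r by (subst norm_of_real[of r, symmetric, where 'a=complex, unfolded abs_of_pos[OF r(1)]], subst norm_mult[symmetric])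
       (simp add: B_def algebra_simps)
  also have "of_real r * z + 1 = z * cnj A"
    using zz by (simp add: A_def algebra_simps)
  also have "norm \<dots> = norm A" using z by (simp add: norm_mult)
  finally have nB: "norm B = norm A / r" using r by (simp add: field_simps)
  have "A \<noteq> 0"
    using z r by (metis A_def add_eq_0_iff norm_minus_cancel norm_of_real abs_of_pos less_irrefl)
  then have a: "norm A > 0" "B \<noteq> 0" using nB r by auto
  have e: "1 / A\<^sup>2 - 1 / B\<^sup>2 = (B - A) * (A + B) / (A\<^sup>2 * B\<^sup>2)"
    using a by (simp add: field_simps power2_eq_square)
  have d: "norm (B - A) = (1 - r\<^sup>2) / r"
  proof -
    have "B - A = of_real (1/r - r)" by (simp add: A_def B_def)
    then have "norm (B - A) = \<bar>1/r - r\<bar>" by (simp only: norm_of_real)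
    moreover have "1/r - r = (1 - r\<^sup>2) / r" using r by (simp add: field_simps power2_eq_square)
    moreover have "r\<^sup>2 \<le> 1" using r by (simp add: power_le_one)
    ultimately show ?thesis using r by simp
  qed
  have "norm (A + B) \<le> norm A * (1 + 1/r)"
    using norm_triangle_ineq[of A B] nB by (simp add: algebra_simps)
  then have "norm (1 / A\<^sup>2 - 1 / B\<^sup>2) \<le> (1 - r\<^sup>2) / r * (norm A * (1 + 1/r)) / (norm A ^ 2 * (norm A / r)^2)"
    unfolding e norm_divide norm_mult norm_power d nB using r
    by (intro divide_right_mono mult_left_mono) (auto simp: power_le_one)
  also have "\<dots> = (1 - r\<^sup>2) * (1 + r) / norm A ^ 3"
    using r a by (simp add: divide_simps power2_eq_square power3_eq_cube)
  also have "\<dots> \<le> 4 * (1 - r) / norm A ^ 3"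
  proof (rule divide_right_mono)
    have "(1 - r\<^sup>2) * (1 + r) = (1 - r) * (1 + r)\<^sup>2" by (simp add: power2_eq_square algebra_simps)
    also have "\<dots> \<le> (1 - r) * 2\<^sup>2" using r by (intro mult_left_mono power_mono) auto
    finally show "(1 - r\<^sup>2) * (1 + r) \<le> 4 * (1 - r)" by simp
  qed auto
  finally show ?thesis by (simp add: A_def B_def)
qed

text \<open>
  The kernel of the Cauchy formula for \<open>U'(-r)\<close> is too singular, so the same kernel at the reflected
  point \<open>-1/r\<close>, which contributes \<open>0\<close>, is subtracted: the difference decays like
  \<open>(1-r)/|z+r|^3\<close> and can be integrated against \<open>|U(z) - U(-1)| \<le> l |arg(-z)|\<close>. The base point \<open>-1\<close>
  is the midpoint of the parameter interval \<open>[0, 2\<pi>]\<close> of the circle.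
\<close>

lemma norm_le_of_circle_averages_pi:
  fixes u :: "complex \<Rightarrow> complex"
  assumes R: "1 < R" and hol: "u holomorphic_on ball 0 R" and r: "1/2 \<le> r" "r < 1"
    and avg: "\<And>s. 0 < s \<Longrightarrow> s \<le> pi \<Longrightarrow> integral {pi - s..pi + s} (\<lambda>t. norm (u (cis t))) \<le> l * s"
  shows "norm (u (- of_real r)) \<le> 180 * l"
proof -
  have l: "0 \<le> l"
  proof -
    have "0 \<le> integral {pi - 1..pi + 1} (\<lambda>t. norm (u (cis t)))"
      by (intro integral_nonneg integrable_continuous_real continuous_intros
          continuous_on_compose2[OF holomorphic_on_imp_continuous_on[OF hol]])
         (use R in auto)
    with avg[of 1] pi_ge_two show ?thesis by simp
  qed
  \<comment> \<open>The hypothesis controls only integrals of \<open>|u|\<close>. Passing to a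
    primitive turns it into the pointwise bound \<open>|V (cis t)| <= l * |t - pi|\<close>, and
    \<open>u (-r)\<close> is recovered as a derivative of \<open>V\<close>.\<close>
  obtain U where "\<And>x. x \<in> ball 0 R \<Longrightarrow> (U has_field_derivative u x) (at x within ball 0 R)"
    using holomorphic_convex_primitive'[OF convex_ball open_ball hol] by blast
  then have U: "(U has_field_derivative u x) (at x)" if "norm x < R" for x
    using that by (simp add: at_within_open[OF _ open_ball])
  define V where "V z = U z - U (-1)" for z
  have V: "(V has_field_derivative u x) (at x)" if "norm x < R" for x
    unfolding V_def using U[OF that] by (auto intro!: derivative_eq_intros)
  have Vhol: "V holomorphic_on ball 0 R"
    unfolding holomorphic_on_open[OF open_ball] using V by (auto intro!: exI)
  define w w' where "w = - complex_of_real r" and "w' = - complex_of_real (1/r)"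
  have r0: "0 < r" using r by simp
  have cu: "continuous_on S (\<lambda>t. u (cis t))" for S :: "real set"
    by (intro continuous_intros
          continuous_on_compose2[OF holomorphic_on_imp_continuous_on[OF hol]]) (use R in auto)
  have 1: "((\<lambda>z. V z / (z - w) ^ 2) has_contour_integral 2 * pi * \<i> * u w) (circlepath 0 1)"
  proof -
    have "((\<lambda>z. V z / (z - w) ^ (Suc 1)) has_contour_integral ((2 * pi * \<i>) / (fact 1) * (deriv ^^ 1) V w)) (circlepath 0 1)"
    proof (rule Cauchy_has_contour_integral_higher_derivative_circlepath)
      show "continuous_on (cball 0 1) V" 
        using R by (intro holomorphic_on_imp_continuous_on holomorphic_on_subset[OF Vhol]) auto
      show "V holomorphic_on ball 0 1"
        using R by (intro holomorphic_on_subset[OF Vhol]) auto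
    qed (use r r0 in \<open>auto simp: w_def\<close>)
    moreover have "deriv V w = u w" using V[of w] r r0 R by (simp add: DERIV_imp_deriv w_def)
    ultimately show ?thesis by (simp add: numeral_2_eq_2)
  qed
  have 2: "((\<lambda>z. V z / (z - w') ^ 2) has_contour_integral 0) (circlepath 0 1)"
  proof (rule Cauchy_theorem_disc_simple[where a=0 and e="min R (1/r)"])
    show "(\<lambda>z. V z / (z - w') ^ 2) holomorphic_on ball 0 (min R (1/r))"
    proof (intro holomorphic_intros holomorphic_on_subset[OF Vhol])
      fix z :: complex assume "z \<in> ball 0 (min R (1/r))"
      moreover have "norm w' = 1/r" using r0 by (simp add: w'_def norm_divide)
      ultimately show "(z - w')\<^sup>2 \<noteq> 0" by auto
    qed auto
  qed (use R r r0 in auto)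
  have "((\<lambda>z. V z / (z - w) ^ 2 - V z / (z - w') ^ 2) has_contour_integral 2 * pi * \<i> * u w) (part_circlepath 0 1 0 (2*pi))"
    using has_contour_integral_diff[OF 1 2] by (simp add: circlepath_def)
  then have 3: "((\<lambda>t. (V (cis t) / (cis t - w) ^ 2 - V (cis t) / (cis t - w') ^ 2) * \<i> * cis t)
      has_integral 2 * pi * \<i> * u w) {0..2*pi}" (is "(?F has_integral _) _")
    by (subst (asm) has_contour_integral_part_circlepath_iff) auto
  have Vb: "norm (V (cis t)) \<le> l * \<bar>t - pi\<bar>" if t: "0 \<le> t" "t \<le> 2*pi" for t
  proof -
    have vd: "((\<lambda>t. V (cis t)) has_vector_derivative u (cis t) * (\<i> * cis t)) (at t within S)" for t S
    proof -
      have "(cis has_vector_derivative (\<i> * cis t)) (at t within S)"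
        by (auto intro!: derivative_eq_intros simp: has_vector_derivative_def scaleR_conv_of_real mult_ac)
      from field_vector_diff_chain_within[OF this, of V "u (cis t)"] show ?thesis
        using V[of "cis t"] R by (simp add: o_def has_field_derivative_at_within mult_ac)
    qed
    have ci: "(\<lambda>t. norm (u (cis t))) integrable_on {a..b}" for a b
      by (intro integrable_continuous_real continuous_intros cu)
    define s where "s = \<bar>t - pi\<bar>"
    define a b where "a = min t pi" and "b = max t pi"
    have ab: "a \<le> b" "{a..b} \<subseteq> {pi - s..pi + s}" "s \<le> pi" using t by (auto simp: a_def b_def s_def)
    have "((\<lambda>t. u (cis t) * (\<i> * cis t)) has_integral (V (cis b) - V (cis a))) {a..b}"
      by (rule fundamental_theorem_of_calculus[OF ab(1) vd])
    then have "norm (V (cis b) - V (cis a)) \<le> integral {a..b} (\<lambda>t. norm (u (cis t)))"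
      by (subst integral_unique[symmetric], assumption, intro integral_norm_bound_integral ci)
         (auto simp: norm_mult)
    also have "\<dots> \<le> integral {pi - s..pi + s} (\<lambda>t. norm (u (cis t)))"
      by (intro integral_subset_le ab ci) auto
    also have "\<dots> \<le> l * s"
      using avg[of s] ab(3) by (cases "s = 0") (auto simp: s_def)
    finally have "norm (V (cis b) - V (cis a)) \<le> l * s" .
    moreover have "V (cis pi) = 0" by (simp add: V_def)
    then have "norm (V (cis b) - V (cis a)) = norm (V (cis t))"
      by (auto simp: a_def b_def min_def max_def)
    ultimately show ?thesis by (simp add: s_def)
  qed
  define d where "d = 1 - r"
  have d: "0 < d" using r by (simp add: d_def)
  \<comment> \<open>With \<open>A = |cis t + r|\<close> and \<open>A^2 >= Q / 18\<close>, one has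
    \<open>|t - pi| <= 5 * A\<close> because \<open>18 <= 25\<close>. The constant is
    \<open>5 * 4 * 18\<close>, the 4 coming from \<open>norm_kernel_le\<close>.\<close>
  have Fb: "norm (?F t) \<le> 360 * l * (d / (d\<^sup>2 + (t - pi)\<^sup>2))" if t: "t \<in> {0..2*pi}" for t
  proof -
    define A where "A = norm (cis t + of_real r)"
    define Q where "Q = d\<^sup>2 + (t - pi)\<^sup>2"
    have Q: "0 < Q" "(t-pi)\<^sup>2 \<le> Q" using d by (simp_all add: Q_def add_pos_nonneg)
    have A2: "Q / 18 \<le> A\<^sup>2"
      using norm_cis_add_ge[OF r] t by (auto simp: A_def Q_def d_def)
    have "A \<noteq> 0" using A2 Q by auto
    moreover have "0 \<le> A" by (simp add: A_def)
    ultimately have A: "0 < A" by simp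
    have "\<bar>t - pi\<bar>\<^sup>2 \<le> (5 * A)\<^sup>2" using A2 Q by (simp add: power_mult_distrib)
    then have x: "\<bar>t - pi\<bar> \<le> 5 * A" by (rule power2_le_imp_le) (use A in simp)
    have "?F t = V (cis t) * (1 / (cis t + of_real r)\<^sup>2 - 1 / (cis t + of_real (1/r))\<^sup>2) * \<i> * cis t"
      by (simp add: w_def w'_def algebra_simps)
    then have "norm (?F t) = norm (V (cis t)) * norm (1 / (cis t + of_real r)\<^sup>2 - 1 / (cis t + of_real (1/r))\<^sup>2)"
      by (simp only: norm_mult norm_cis norm_ii mult_1_right)
    also have "\<dots> \<le> (l * \<bar>t - pi\<bar>) * (4 * (1 - r) / norm (cis t + of_real r) ^ 3)"
      using t r0 r l by (intro mult_mono Vb norm_kernel_le) auto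
    also have "\<dots> \<le> (l * (5 * A)) * (4 * d / A ^ 3)"
      unfolding A_def[symmetric] d_def[symmetric] using x l d A by (intro mult_right_mono mult_left_mono) auto
    also have "\<dots> = 20 * l * d * (1 / A\<^sup>2)"
      using A by (simp add: field_simps power2_eq_square power3_eq_cube)
    also have "1 / A\<^sup>2 \<le> 18 / Q" using A2 A Q by (simp add: field_simps)
    then have "20 * l * d * (1 / A\<^sup>2) \<le> 20 * l * d * (18 / Q)" using l d by (intro mult_left_mono) auto
    finally show ?thesis by (simp add: Q_def)
  qed
  \<comment> \<open>The majorant is a multiple of the derivative of
    \<open>arctan ((t - pi) / d)\<close>, so its integral is at most \<open>360 * l * pi\<close>
    whatever \<open>d\<close> is. Division by \<open>2 * pi\<close> leaves 180.\<close>
  have G: "((\<lambda>t. 360 * l * (d / (d\<^sup>2 + (t - pi)\<^sup>2))) has_integral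
      360 * l * (arctan ((2*pi - pi) / d) - arctan ((0 - pi) / d))) {0..2*pi}"
  proof (intro has_integral_mult_right fundamental_theorem_of_calculus)
    show "((\<lambda>t. arctan ((t - pi) / d)) has_vector_derivative d / (d\<^sup>2 + (t - pi)\<^sup>2)) (at t within {0..2*pi})" for t
    proof -
      have "((\<lambda>t. arctan ((t - pi) / d)) has_real_derivative (inverse (1 + ((t - pi) / d)\<^sup>2) * (1 / d))) (at t within {0..2*pi})"
        using d by (auto intro!: derivative_eq_intros simp: field_simps)
      moreover have "inverse (1 + ((t - pi) / d)\<^sup>2) * (1 / d) = d / (d\<^sup>2 + (t - pi)\<^sup>2)"
      proof -
        have "1 + ((t - pi) / d)\<^sup>2 = (d\<^sup>2 + (t - pi)\<^sup>2) / d\<^sup>2" using d by (simp add: field_simps)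
        then show ?thesis using d by (simp add: power2_eq_square)
      qed
      ultimately show ?thesis by (simp add: has_real_derivative_iff_has_vector_derivative)
    qed
  qed auto
  have "norm (2 * pi * \<i> * u w) \<le> integral {0..2*pi} (\<lambda>t. 360 * l * (d / (d\<^sup>2 + (t - pi)\<^sup>2)))"
    unfolding integral_unique[OF 3, symmetric]
    using 3 G Fb by (intro integral_norm_bound_integral) blast+
  also have "\<dots> = 360 * l * (arctan ((2*pi - pi) / d) - arctan ((0 - pi) / d))"
    using G by blast
  also have "\<dots> \<le> 360 * l * pi"
    using l arctan_ubound[of "(2*pi - pi) / d"] arctan_lbound[of "(0-pi)/d"]
    by (intro mult_left_mono) auto
  finally show ?thesis by (simp add: norm_mult w_def)
qed

section \<open>Parseval's formula and the mean size of dilation differences\<close>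

lemma tannery_uniform_bound:
  fixes a :: "nat \<Rightarrow> _ \<Rightarrow> 'a :: {real_normed_algebra, banach}"
  assumes "\<And>k. ((\<lambda>n. a k n) \<longlongrightarrow> b k) F" and ev: "\<forall>\<^sub>F n in F. \<forall>k. norm (a k n) \<le> M k"
    and "summable M" "F \<noteq> bot"
  shows "((\<lambda>n. \<Sum>k. a k n) \<longlongrightarrow> (\<Sum>k. b k)) F"
proof -
  have "eventually (\<lambda>(k,n). norm (a k n) \<le> M k) (at_top \<times>\<^sub>F F)"
    by (rule eventually_mono[OF eventually_prodI[OF eventually_True ev]]) auto
  from tannerys_theorem[OF assms(1) this assms(3,4)] show ?thesis by blast
qed

lemma has_integral_cis_int:
  fixes k :: int
  shows "((\<lambda>t. cis (of_int k * t)) has_integral (if k = 0 then 2 * pi else 0)) {0..2*pi}"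
proof (cases "k = 0")
  case True
  then show ?thesis using has_integral_const_real[of "1::complex" 0 "2*pi"] by (simp add: scaleR_conv_of_real)
next
  case False
  have "((\<lambda>t. cis (of_int k * t)) has_integral
      (cis (of_int k * (2*pi)) / (\<i> * of_int k) - cis (of_int k * 0) / (\<i> * of_int k))) {0..2*pi}"
    by (rule fundamental_theorem_of_calculus)
       (auto intro!: derivative_eq_intros simp: has_vector_derivative_def False scaleR_conv_of_real field_simps)
  moreover have "cis (of_int k * (2*pi)) = 1"
    by (metis cis_multiple_2pi Ints_of_int mult.commute)
  ultimately show ?thesis using False by simp
qed

text \<open>Expanding the square as a double sum, orthogonality of the functions
  \<open>cis (k * t)\<close> leaves the diagonal.\<close>

lemma parseval_trig_poly:
  fixes d :: "nat \<Rightarrow> complex"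
  shows "((\<lambda>t. (norm (\<Sum>n<N. d n * cis (real n * t)))\<^sup>2) has_integral 2 * pi * (\<Sum>n<N. (norm (d n))\<^sup>2)) {0..2*pi}"
proof -
  have "((\<lambda>t. \<Sum>n<N. \<Sum>m<N. d n * cnj (d m) * cis (of_int (int n - int m) * t)) has_integral
      (\<Sum>n<N. \<Sum>m<N. d n * cnj (d m) * (if int n - int m = 0 then 2 * pi else 0))) {0..2*pi}"
    by (intro has_integral_sum has_integral_mult_right has_integral_cis_int) auto
  also have "(\<Sum>n<N. \<Sum>m<N. d n * cnj (d m) * (if int n - int m = 0 then 2 * pi else 0))
     = of_real (2 * pi * (\<Sum>n<N. (norm (d n))\<^sup>2))"
  proof -
    have "(\<Sum>m<N. d n * cnj (d m) * (if int n - int m = 0 then 2 * pi else 0)) = of_real (2 * pi * (norm (d n))\<^sup>2)"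
      if "n < N" for n
    proof -
      have "(\<Sum>m<N. d n * cnj (d m) * (if int n - int m = 0 then 2 * pi else 0)) =
        (\<Sum>m<N. if n = m then d n * cnj (d m) * (2 * pi) else 0)"
        by (intro sum.cong) auto
      also have "\<dots> = d n * cnj (d n) * (2 * pi)" using that by simp
      finally show ?thesis by (simp add: complex_norm_square[symmetric] mult_ac)
    qed
    then show ?thesis by (simp add: sum_distrib_left)
  qed
  finally have I: "((\<lambda>t. \<Sum>n<N. \<Sum>m<N. d n * cnj (d m) * cis (of_int (int n - int m) * t)) has_integral
      of_real (2 * pi * (\<Sum>n<N. (norm (d n))\<^sup>2))) {0..2*pi}" .
  have e: "(\<Sum>n<N. \<Sum>m<N. d n * cnj (d m) * cis (of_int (int n - int m) * t)) =
      of_real ((norm (\<Sum>n<N. d n * cis (real n * t)))\<^sup>2)" for t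
    unfolding complex_norm_square cnj_sum sum_product
    by (intro sum.cong refl) (simp add: cis_cnj cis_mult algebra_simps)
  show ?thesis using has_integral_linear[OF I bounded_linear_Re] unfolding e by (simp add: o_def)
qed

text \<open>Absolute summability supplies a constant majorant for dominated convergence. It is
  available in the application, where the \<open>d n\<close> come from power series coefficients on
  a circle of radius below 1.\<close>

lemma parseval_series:
  fixes d :: "nat \<Rightarrow> complex"
  assumes "summable (\<lambda>n. norm (d n))"
  shows "summable (\<lambda>n. (norm (d n))\<^sup>2)"
    and "((\<lambda>t. (norm (\<Sum>n. d n * cis (real n * t)))\<^sup>2) has_integral 2 * pi * (\<Sum>n. (norm (d n))\<^sup>2)) {0..2*pi}"
proof -
  have ev: "\<forall>\<^sub>F n in sequentially. norm (d n) < 1"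
    using summable_LIMSEQ_zero[OF assms] by (rule order_tendstoD) auto
  show sm: "summable (\<lambda>n. (norm (d n))\<^sup>2)"
  proof (rule summable_comparison_test_ev[OF _ assms])
    show "\<forall>\<^sub>F n in sequentially. norm ((norm (d n))\<^sup>2) \<le> norm (d n)"
      using ev by eventually_elim (simp add: power2_eq_square mult_left_le)
  qed
  show "((\<lambda>t. (norm (\<Sum>n. d n * cis (real n * t)))\<^sup>2) has_integral 2 * pi * (\<Sum>n. (norm (d n))\<^sup>2)) {0..2*pi}"
  proof (rule has_integral_dominated_convergence[OF parseval_trig_poly])
    show "(\<lambda>_. (\<Sum>n. norm (d n))\<^sup>2) integrable_on {0..2*pi}" by (rule integrable_const_ivl)
    show "\<forall>t\<in>{0..2*pi}. norm ((norm (\<Sum>n<N. d n * cis (real n * t)))\<^sup>2) \<le> (\<Sum>n. norm (d n))\<^sup>2" for N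
    proof
      fix t
      have "norm (\<Sum>n<N. d n * cis (real n * t)) \<le> (\<Sum>n<N. norm (d n))"
        by (rule order_trans[OF norm_sum]) (simp add: norm_mult)
      also have "\<dots> \<le> (\<Sum>n. norm (d n))" by (intro sum_le_suminf assms) auto
      finally show "norm ((norm (\<Sum>n<N. d n * cis (real n * t)))\<^sup>2) \<le> (\<Sum>n. norm (d n))\<^sup>2"
        by (simp add: power_mono)
    qed
    show "\<forall>t\<in>{0..2*pi}. (\<lambda>N. (norm (\<Sum>n<N. d n * cis (real n * t)))\<^sup>2) \<longlonglongrightarrow> (norm (\<Sum>n. d n * cis (real n * t)))\<^sup>2"
      by (intro ballI tendsto_intros summable_LIMSEQ summable_norm_cancel[where f="\<lambda>n. d n * cis (real n * _)"])
         (simp add: norm_mult assms)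
    show "(\<lambda>N. 2 * pi * (\<Sum>n<N. (norm (d n))\<^sup>2)) \<longlonglongrightarrow> 2 * pi * (\<Sum>n. (norm (d n))\<^sup>2)"
      by (intro tendsto_intros summable_LIMSEQ sm)
  qed
qed

lemma holomorphic_disc_series:
  fixes f :: "complex \<Rightarrow> complex"
  assumes hol: "f holomorphic_on ball 0 1"
  obtains c where "\<And>z. norm z < 1 \<Longrightarrow> summable (\<lambda>n. norm (c n * z ^ n))"
    and "\<And>z. norm z < 1 \<Longrightarrow> (\<lambda>n. c n * z ^ n) sums f z"
proof
  define c where "c n = (deriv ^^ n) f 0 / fact n" for n
  show s: "(\<lambda>n. c n * z ^ n) sums f z" if "norm z < 1" for z
    using holomorphic_power_series[OF hol, of z] that by (simp add: c_def)
  show "summable (\<lambda>n. norm (c n * z ^ n))" if z: "norm z < 1" for z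
  proof -
    obtain r where r: "norm z < r" "r < 1" using z dense by blast
    then have "summable (\<lambda>n. c n * of_real r ^ n)"
      using s[of "of_real r"] order.strict_trans1[OF norm_ge_zero r(1)] by (auto simp: sums_iff)
    from powser_insidea[OF this, of z] show ?thesis using r order.strict_trans1[OF norm_ge_zero r(1)] by simp
  qed
qed

text \<open>Letting the radius tend to 1 in Parseval's formula bounds the sum of
  \<open>|c n|^2\<close> by \<open>M^2\<close>. On radius \<open>R\<close> the mean square of the
  difference is at most the sum of \<open>|c n|^2 * (1 - s^n)^2\<close>, which is free of
  \<open>R\<close> and tends to 0 as \<open>s\<close> tends to 1, by Tannery's theorem.\<close>

lemma dilation_L1_small:
  fixes f :: "complex \<Rightarrow> complex"
  assumes hol: "f holomorphic_on ball 0 1" and M: "\<And>z. norm z < 1 \<Longrightarrow> norm (f z) \<le> M" and e: "0 < e"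
  obtains s where "1/2 \<le> s" "s < 1" 
    "\<forall>R\<in>{0<..<1}. integral {0..2*pi} (\<lambda>t. norm (f (of_real R * cis t) - f (of_real (s * R) * cis t))) \<le> e"
proof -
  obtain c where c: "\<And>z. norm z < 1 \<Longrightarrow> summable (\<lambda>n. norm (c n * z ^ n))"
      "\<And>z. norm z < 1 \<Longrightarrow> (\<lambda>n. c n * z ^ n) sums f z"
    using holomorphic_disc_series[OF hol] by blast
  have M0: "0 \<le> M" using M[of 0] norm_ge_zero[of "f 0"] by (simp del: norm_ge_zero)
  have pw: "(of_real R * cis t) ^ n = of_real R ^ n * cis (real n * t)" for R t n
    by (simp only: power_mult_distrib Complex.DeMoivre)
  have fs: "f (of_real R * cis t) = (\<Sum>n. c n * of_real R ^ n * cis (real n * t))" if "0 < R" "R < 1" for R t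
    using sums_unique[OF c(2)[of "of_real R * cis t"]] that
    by (simp add: norm_mult pw mult.assoc)
  have cR: "summable (\<lambda>n. norm (c n * of_real R ^ n))" if "0 < R" "R < 1" for R :: real
    using c(1)[of "of_real R"] that by simp
  have b: "(\<Sum>n<N. (norm (c n * of_real R ^ n))\<^sup>2) \<le> M\<^sup>2" if R: "0 < R" "R < 1" for R :: real and N
  proof -
    note p = parseval_series[OF cR[OF R]]
    have "2 * pi * (\<Sum>n. (norm (c n * of_real R ^ n))\<^sup>2) \<le> 2 * pi * M\<^sup>2"
    proof (rule has_integral_le[OF p(2)])
      show "((\<lambda>t. M\<^sup>2) has_integral 2 * pi * M\<^sup>2) {0..2*pi}"
        using has_integral_const_real[of "M\<^sup>2" 0 "2*pi"] by simp
      show "(norm (\<Sum>n. c n * complex_of_real R ^ n * cis (real n * t)))\<^sup>2 \<le> M\<^sup>2" for t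
        unfolding fs[OF R, symmetric] using R by (intro power_mono M) (auto simp: norm_mult)
    qed
    moreover have "(\<Sum>n<N. (norm (c n * of_real R ^ n))\<^sup>2) \<le> (\<Sum>n. (norm (c n * of_real R ^ n))\<^sup>2)"
      by (intro sum_le_suminf p(1)) auto
    ultimately show ?thesis by simp
  qed
  have ev01: "\<forall>\<^sub>F R in at_left (1::real). R \<in> {0<..<1}"
    by (rule eventually_at_left_real) simp
  have bc: "(\<Sum>n<N. (norm (c n))\<^sup>2) \<le> M\<^sup>2" for N
  proof (rule tendsto_upperbound)
    show "((\<lambda>R::real. \<Sum>n<N. (norm (c n * of_real R ^ n))\<^sup>2) \<longlongrightarrow> (\<Sum>n<N. (norm (c n))\<^sup>2)) (at_left 1)"
      by (auto intro!: tendsto_eq_intros)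
    show "\<forall>\<^sub>F R in at_left (1::real). (\<Sum>n<N. (norm (c n * of_real R ^ n))\<^sup>2) \<le> M\<^sup>2"
      using ev01 by eventually_elim (use b in auto)
  qed auto
  have sc: "summable (\<lambda>n. (norm (c n))\<^sup>2)"
  proof (rule bounded_imp_summable)
    show "(\<Sum>n\<le>N. (norm (c n))\<^sup>2) \<le> M\<^sup>2" for N
      using bc[of "Suc N"] by (simp only: lessThan_Suc_atMost)
  qed simp
  have lim: "((\<lambda>s::real. \<Sum>n. (norm (c n))\<^sup>2 * (1 - s ^ n)\<^sup>2) \<longlongrightarrow> (\<Sum>n. (norm (c n))\<^sup>2 * (1 - 1 ^ n)\<^sup>2)) (at_left 1)"
  proof (rule tannery_uniform_bound)
    show "((\<lambda>s::real. (norm (c n))\<^sup>2 * (1 - s ^ n)\<^sup>2) \<longlongrightarrow> (norm (c n))\<^sup>2 * (1 - 1 ^ n)\<^sup>2) (at_left 1)" for n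
      by (intro tendsto_intros)
    show "\<forall>\<^sub>F s in at_left (1::real). \<forall>n. norm ((norm (c n))\<^sup>2 * (1 - s ^ n)\<^sup>2) \<le> (norm (c n))\<^sup>2"
      using ev01
      by eventually_elim (auto intro!: mult_left_le power_le_one simp: power_le_one)
  qed (use sc in auto)
  \<comment> \<open>Fixed by the last estimate: \<open>x <= \<delta>/2 + x^2/(2*\<delta>)\<close>
    converts mean squares into means, and integration over a period then gives
    \<open>2 * pi * \<delta> = e\<close>.\<close>
  define \<delta> where "\<delta> = e / (2 * pi)"
  have \<delta>: "0 < \<delta>" using e by (simp add: \<delta>_def)
  have "\<forall>\<^sub>F s in at_left (1::real). (\<Sum>n. (norm (c n))\<^sup>2 * (1 - s ^ n)\<^sup>2) < \<delta>\<^sup>2"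
    using \<delta> by (intro order_tendstoD[OF lim]) simp
  moreover have "\<forall>\<^sub>F s in at_left (1::real). s \<in> {1/2<..<1}"
    by (rule eventually_at_left_real) simp
  ultimately have "\<forall>\<^sub>F s in at_left (1::real). (\<Sum>n. (norm (c n))\<^sup>2 * (1 - s ^ n)\<^sup>2) < \<delta>\<^sup>2 \<and> s \<in> {1/2<..<1}"
    by (rule eventually_conj)
  then obtain s :: real where s: "(\<Sum>n. (norm (c n))\<^sup>2 * (1 - s ^ n)\<^sup>2) < \<delta>\<^sup>2" "1/2 < s" "s < 1"
    using eventually_happens'[of "at_left (1::real)"] by auto
  have s1: "0 \<le> 1 - s ^ n" "1 - s ^ n \<le> 1" for n using s by (auto simp: power_le_one)
  show ?thesis
  proof (rule that[of s], use s in simp, rule s(3), rule ballI)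
    fix R :: real assume "R \<in> {0<..<1}"
    then have R: "0 < R" "R < 1" by auto
    define d where "d n = c n * of_real R ^ n * of_real (1 - s ^ n)" for n
    define G where "G t = f (of_real R * cis t) - f (of_real (s * R) * cis t)" for t
    have sR: "0 < s * R" "s * R < 1" using s R mult_strict_mono[of s 1 R 1] by auto
    have "norm (d n) \<le> norm (c n * of_real R ^ n)" for n
      unfolding d_def norm_mult[of _ "of_real (1 - s ^ n)"] norm_of_real using s1[of n] by (intro mult_left_le) auto
    then have sd: "summable (\<lambda>n. norm (d n))"
      by (intro summable_comparison_test'[OF cR[OF R]]) auto
    have sm: "summable (\<lambda>n. c n * of_real r ^ n * cis (real n * t))" if "0 < r" "r < 1" for r t
      by (rule summable_norm_cancel) (use cR[OF that] in \<open>simp add: norm_mult\<close>)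
    have G: "G t = (\<Sum>n. d n * cis (real n * t))" for t
      unfolding G_def fs[OF R] fs[OF sR]
      by (subst suminf_diff[OF sm[OF R] sm[OF sR]])
         (simp add: d_def algebra_simps power_mult_distrib)
    note p = parseval_series[OF sd, folded G]
    have "(norm (d n))\<^sup>2 \<le> (norm (c n))\<^sup>2 * (1 - s ^ n)\<^sup>2" for n
    proof -
      have "norm (d n) \<le> norm (c n) * (1 - s ^ n)"
        unfolding d_def norm_mult norm_of_real norm_power
        using R s1[of n] by (intro mult_mono) (auto simp: power_le_one mult_left_le)
      from power_mono[OF this norm_ge_zero, of 2] show ?thesis by (simp add: power_mult_distrib)
    qed
    moreover have "summable (\<lambda>n. (norm (c n))\<^sup>2 * (1 - s ^ n)\<^sup>2)"
      by (rule summable_comparison_test'[OF sc]) (use s1 in \<open>auto intro!: mult_left_le power_le_one\<close>)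
    ultimately have "(\<Sum>n. (norm (d n))\<^sup>2) \<le> (\<Sum>n. (norm (c n))\<^sup>2 * (1 - s ^ n)\<^sup>2)"
      by (intro suminf_le p(1)) auto
    with s(1) have dd: "(\<Sum>n. (norm (d n))\<^sup>2) \<le> \<delta>\<^sup>2" by simp
    have H: "((\<lambda>t. \<delta> / 2 + (norm (G t))\<^sup>2 * (1 / (2 * \<delta>))) has_integral
        (2 * pi * (\<delta> / 2) + 2 * pi * (\<Sum>n. (norm (d n))\<^sup>2) * (1 / (2 * \<delta>)))) {0..2*pi}"
      using has_integral_const_real[of "\<delta>/2" 0 "2*pi"]
      by (intro has_integral_add has_integral_mult_left p(2)) (simp only: content_real_if; simp)
    have Gc: "continuous_on {0..2*pi} G"
      unfolding G_def using R sR
      by (intro continuous_intros continuous_on_compose2[OF holomorphic_on_imp_continuous_on[OF hol]])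
         (auto simp: norm_mult)
    have "integral {0..2*pi} (\<lambda>t. norm (G t)) \<le> integral {0..2*pi} (\<lambda>t. \<delta> / 2 + (norm (G t))\<^sup>2 * (1 / (2 * \<delta>)))"
    proof (rule integral_le)
      show "(\<lambda>t. norm (G t)) integrable_on {0..2*pi}"
        by (intro integrable_continuous_real continuous_intros Gc)
      show "(\<lambda>t. \<delta> / 2 + (norm (G t))\<^sup>2 * (1 / (2 * \<delta>))) integrable_on {0..2*pi}" using H by blast
      fix t
      have "0 \<le> (norm (G t) - \<delta>)\<^sup>2" by simp
      then show "norm (G t) \<le> \<delta> / 2 + (norm (G t))\<^sup>2 * (1 / (2 * \<delta>))"
        using \<delta> by (simp add: field_simps power2_eq_square)
    qed
    also have "\<dots> = 2 * pi * (\<delta> / 2) + 2 * pi * (\<Sum>n. (norm (d n))\<^sup>2) * (1 / (2 * \<delta>))"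
      using H by blast
    also have "\<dots> \<le> 2 * pi * (\<delta> / 2) + 2 * pi * \<delta>\<^sup>2 * (1 / (2 * \<delta>))"
      using dd \<delta> by (intro add_left_mono mult_right_mono mult_left_mono) auto
    also have "\<dots> = e" using \<delta> by (simp add: power2_eq_square \<delta>_def)
    finally show "integral {0..2*pi} (\<lambda>t. norm (f (of_real R * cis t) - f (of_real (s * R) * cis t))) \<le> e"
      by (simp add: G_def)
  qed
qed

section \<open>The radial maximal function and existence of radial limits\<close>

lemma norm_le_of_circle_averages:
  fixes u :: "complex \<Rightarrow> complex"
  assumes R: "1 < R" and hol: "u holomorphic_on ball 0 R" and r: "1/2 \<le> r" "r < 1"
    and avg: "\<And>s. 0 < s \<Longrightarrow> s \<le> pi \<Longrightarrow> integral {\<theta> - s..\<theta> + s} (\<lambda>t. norm (u (cis t))) \<le> l * s"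
  shows "norm (u (of_real r * cis \<theta>)) \<le> 180 * l"
proof -
  define v where "v z = u (cis (\<theta> - pi) * z)" for z
  have "norm (v (- of_real r)) \<le> 180 * l"
  proof (rule norm_le_of_circle_averages_pi[OF R _ r])
    show "v holomorphic_on ball 0 R"
      unfolding v_def by (rule holomorphic_on_compose_gen[OF _ hol, unfolded o_def])
        (auto intro!: holomorphic_intros simp: norm_mult)
    show "integral {pi - s..pi + s} (\<lambda>t. norm (v (cis t))) \<le> l * s" if "0 < s" "s \<le> pi" for s
      using avg[OF that] integral_shift_real_ivl[of "\<theta> - s" "\<theta> - pi" "\<theta> + s" "\<lambda>t. norm (u (cis t))"]
      by (simp add: v_def cis_mult add.commute algebra_simps)
  qed
  moreover have "cis (\<theta> - pi) * (- of_real r) = of_real r * cis \<theta>"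
    by (simp add: cis_divide[symmetric])
  ultimately show ?thesis by (simp add: v_def)
qed

text \<open>The union over \<open>P\<close> may be uncountable, but each member is open by
  continuity, so the union is open and hence measurable.\<close>

lemma lmeasurable_ex_norm_gt:
  fixes G :: "'r \<Rightarrow> real \<Rightarrow> 'a::real_normed_vector"
  assumes "\<And>r. r \<in> P \<Longrightarrow> continuous_on UNIV (G r)"
  shows "{t\<in>{a..b}. \<exists>r\<in>P. c < norm (G r t)} \<in> lmeasurable"
proof -
  have "{t\<in>{a..b}. \<exists>r\<in>P. c < norm (G r t)} = (\<Union>r\<in>P. {t. c < norm (G r t)}) \<inter> {a..b}"
    by auto
  moreover have "open (\<Union>r\<in>P. {t. c < norm (G r t)})"
    using assms by (intro open_UN ballI open_Collect_less continuous_intros) auto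
  ultimately show ?thesis
    by (intro bounded_set_imp_lmeasurable) (auto intro!: bounded_Int sets.Int lmeasurable_cbox)
qed

text \<open>If every integral over \<open>{\<theta> - s..\<theta> + s}\<close> were at most
  \<open>l * s\<close>, then \<open>norm_le_of_circle_averages\<close> would bound the radial values
  by \<open>180 * l\<close>. So each point of \<open>E\<close> has an interval of the kind required
  by \<open>maximal_function_weak_type\<close>.\<close>

lemma radial_maximal_weak_type:
  fixes u :: "complex \<Rightarrow> complex"
  assumes R: "1 < R" and hol: "u holomorphic_on ball 0 R" and l: "0 < l"
  defines "E \<equiv> {\<theta>\<in>{0..2*pi}. \<exists>r\<in>{1/2..<1}. 180 * l < norm (u (of_real r * cis \<theta>))}"
  shows "E \<in> lmeasurable" and "measure lebesgue E \<le> 30 / l * integral {0..2*pi} (\<lambda>t. norm (u (cis t)))"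
proof -
  have cu: "continuous_on S (\<lambda>t. u (of_real r * cis t))" if "0 \<le> r" "r \<le> 1" for S :: "real set" and r :: real
    using R that
    by (intro continuous_intros
          continuous_on_compose2[OF holomorphic_on_imp_continuous_on[OF hol]]) (auto simp: norm_mult)
  show E: "E \<in> lmeasurable"
    unfolding E_def by (intro lmeasurable_ex_norm_gt cu) auto
  define h where "h t = norm (u (cis t))" for t
  have ch: "continuous_on S h" for S
    using cu[of 1 S] unfolding h_def by (auto intro!: continuous_intros)
  have ih: "h integrable_on {a..b}" for a b by (intro integrable_continuous_real ch)
  have per: "h (t + 2*pi) = h t" "h (t + (- (2*pi))) = h t" for t by (simp_all add: h_def cis_mult[symmetric] cis_divide[symmetric])
  have "measure lebesgue E \<le> 10 / l * integral {0-pi..2*pi+pi} h"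
  proof (rule maximal_function_weak_type[OF ch _ l E])
    fix \<theta> assume "\<theta> \<in> E"
    then obtain r where r: "1/2 \<le> r" "r < 1" "180 * l < norm (u (of_real r * cis \<theta>))"
      by (auto simp: E_def)
    show "\<exists>s>0. s \<le> pi \<and> l * s < integral {\<theta> - s..\<theta> + s} h"
    proof (rule ccontr)
      assume nex: "\<not> (\<exists>s>0. s \<le> pi \<and> l * s < integral {\<theta> - s..\<theta> + s} h)"
      then have "integral {\<theta> - s..\<theta> + s} (\<lambda>t. norm (u (cis t))) \<le> l * s" if "0 < s" "s \<le> pi" for s
      proof -
        have "\<not> l * s < integral {\<theta> - s..\<theta> + s} h" using nex that by blast
        then show ?thesis by (simp add: h_def[abs_def])
      qed
      from norm_le_of_circle_averages[OF R hol r(1,2) this] r(3) show False by simp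
    qed
  qed (auto simp: E_def h_def)
  \<comment> \<open>The intervals around points of one period may stick out by \<open>pi\<close>;
    three full periods contain them all, which turns the factor 10 into 30.\<close>
  also have "integral {0-pi..2*pi+pi} h \<le> integral {-(2*pi)..4*pi} h"
    by (intro integral_subset_le ih) (auto simp: h_def)
  also have "\<dots> = integral {-(2*pi)..0} h + integral {0..2*pi} h + integral {2*pi..4*pi} h"
    by (simp add: Henstock_Kurzweil_Integration.integral_combine ih)
  also have "integral {-(2*pi)..0} h = integral {0..2*pi} h"
    using integral_shift_real_ivl[of 0 "2*pi" "2*pi" h] by (simp add: per)
  also have "integral {2*pi..4*pi} h = integral {0..2*pi} h"
    using integral_shift_real_ivl[of 0 "-(2*pi)" "2*pi" h] by (simp add: per(2)[unfolded add_uminus_conv_diff])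
  finally show "measure lebesgue E \<le> 30 / l * integral {0..2*pi} (\<lambda>t. norm (u (cis t)))"
    using l by (simp add: h_def[abs_def] mult_left_mono divide_right_mono)
qed

text \<open>The weak-type bound needs holomorphy past the unit circle, so it is applied to
  \<open>f (R z) - f (s R z)\<close> with \<open>R < 1\<close>. One \<open>s\<close> serves all
  \<open>R\<close>, because \<open>dilation_L1_small\<close> is uniform in \<open>R\<close>, and the
  exceptional sets increase to the required one as \<open>R\<close> tends to 1.\<close>

lemma dilation_maximal:
  fixes f :: "complex \<Rightarrow> complex"
  assumes hol: "f holomorphic_on ball 0 1" and M: "\<And>z. norm z < 1 \<Longrightarrow> norm (f z) \<le> M" and l: "0 < l" and e: "0 < e"
  obtains s T where "1/2 \<le> s" "s < 1" "T \<in> lmeasurable" "measure lebesgue T \<le> e"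
    "{\<theta>\<in>{0..2*pi}. \<exists>\<rho>\<in>{1/2..<1}. 180 * l < norm (f (of_real \<rho> * cis \<theta>) - f (of_real (s * \<rho>) * cis \<theta>))} \<subseteq> T"
proof -
  \<comment> \<open>This mean size is what the factor \<open>30 / l\<close> of the weak-type
    inequality turns into \<open>e\<close>.\<close>
  have pos: "0 < e * l / 30" using e l by simp
  obtain s where s: "1/2 \<le> s" "s < 1" and
    sI: "\<forall>R\<in>{0<..<1}. integral {0..2*pi} (\<lambda>t. norm (f (of_real R * cis t) - f (of_real (s * R) * cis t))) \<le> e * l / 30"
    by (rule dilation_L1_small[OF hol M pos])
  define R where "R n = 1 - 1 / (real n + 2)" for n
  have R: "0 < R n" "R n < 1" for n by (auto simp: R_def field_simps)
  have Rmono: "R m \<le> R n" if "m \<le> n" for m n using that by (auto simp: R_def frac_le)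
  define A where "A n = {\<theta>\<in>{0..2*pi}. \<exists>\<rho>\<in>{1/2..<R n}. 180 * l < norm (f (of_real \<rho> * cis \<theta>) - f (of_real (s * \<rho>) * cis \<theta>))}" for n
  have A: "A n \<in> lmeasurable" for n
    unfolding A_def
  proof (intro lmeasurable_ex_norm_gt)
    fix \<rho> assume "\<rho> \<in> {1/2..<R n}"
    then have "0 < \<rho>" "\<rho> < 1" "s * \<rho> < 1" "0 < s * \<rho>" using R[of n] s mult_strict_mono[of s 1 \<rho> 1] by auto
    then show "continuous_on UNIV (\<lambda>\<theta>. f (of_real \<rho> * cis \<theta>) - f (of_real (s * \<rho>) * cis \<theta>))"
      by (intro continuous_intros continuous_on_compose2[OF holomorphic_on_imp_continuous_on[OF hol]])
         (auto simp: norm_mult abs_mult)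
  qed
  have Am: "measure lebesgue (A n) \<le> e" for n
  proof -
    define u where "u z = f (of_real (R n) * z) - f (of_real (s * R n) * z)" for z
    have sR: "0 < s * R n" "s * R n < R n" using s R[of n] by auto
    have uh: "u holomorphic_on ball 0 (1 / R n)"
    proof -
      have "norm (of_real (R n) * z) < 1" "norm (of_real (s * R n) * z) < 1" if "norm z < 1 / R n" for z :: complex
      proof -
        show a: "norm (of_real (R n) * z) < 1" using that R[of n] by (simp add: norm_mult field_simps)
        have "norm (of_real (s * R n) * z) \<le> norm (of_real (R n) * z)"
          unfolding norm_mult[of "of_real _"] norm_of_real using sR R[of n] by (intro mult_right_mono) auto
        with a show "norm (of_real (s * R n) * z) < 1" by simp
      qed
      then show ?thesis unfolding u_def
        by (intro holomorphic_intros holomorphic_on_compose_gen[OF _ hol, unfolded o_def]) auto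
    qed
    have R1: "1 < 1 / R n" using R[of n] by simp
    note m = radial_maximal_weak_type[OF R1 uh l]
    have "measure lebesgue (A n) \<le> measure lebesgue {\<theta>\<in>{0..2*pi}. \<exists>r\<in>{1/2..<1}. 180 * l < norm (u (of_real r * cis \<theta>))}"
    proof (rule measure_mono_fmeasurable[OF _ fmeasurableD[OF A] m(1)], rule subsetI)
      fix \<theta> assume "\<theta> \<in> A n"
      then obtain \<rho> where \<rho>: "\<theta> \<in> {0..2*pi}" "1/2 \<le> \<rho>" "\<rho> < R n" "180 * l < norm (f (of_real \<rho> * cis \<theta>) - f (of_real (s * \<rho>) * cis \<theta>))"
        by (auto simp: A_def)
      have "1/2 \<le> \<rho> / R n"
      proof -
        have "1/2 * R n \<le> \<rho>" using \<rho>(2) R[of n] by simp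
        then show ?thesis using R[of n] by (simp add: field_simps)
      qed
      moreover have "\<rho> / R n < 1" using \<rho> R[of n] by simp
      moreover have "u (of_real (\<rho> / R n) * cis \<theta>) = f (of_real \<rho> * cis \<theta>) - f (of_real (s * \<rho>) * cis \<theta>)"
        using R[of n] by (simp add: u_def mult.assoc)
      ultimately show "\<theta> \<in> {\<theta>\<in>{0..2*pi}. \<exists>r\<in>{1/2..<1}. 180 * l < norm (u (of_real r * cis \<theta>))}"
        using \<rho> by (auto intro!: bexI[of _ "\<rho> / R n"])
    qed
    also have "\<dots> \<le> 30 / l * integral {0..2*pi} (\<lambda>t. norm (u (cis t)))" by (rule m(2))
    also have "\<dots> \<le> 30 / l * (e * l / 30)"
      using sI R[of n] l by (intro mult_left_mono) (auto simp: u_def)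
    finally show ?thesis using l by simp
  qed
  \<comment> \<open>The sets are nested, so the bound on a single \<open>A n\<close> is already a
    bound on finite unions and passes to the countable union.\<close>
  have "measure lebesgue (\<Union>i\<le>n. A i) \<le> e" for n
  proof -
    have "A i \<subseteq> A n" if "i \<le> n" for i
      using Rmono[OF that] unfolding A_def by (fastforce intro: less_le_trans)
    then have "(\<Union>i\<le>n. A i) = A n" by auto
    then show ?thesis using Am by simp
  qed
  note U = fmeasurable_countable_Union[OF A this] measure_countable_Union_le[OF A this]
  show ?thesis
  proof (rule that[OF s U], rule subsetI)
    fix \<theta> assume "\<theta> \<in> {\<theta>\<in>{0..2*pi}. \<exists>\<rho>\<in>{1/2..<1}. 180 * l < norm (f (of_real \<rho> * cis \<theta>) - f (of_real (s * \<rho>) * cis \<theta>))}"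
    then obtain \<rho> where \<rho>: "\<theta> \<in> {0..2*pi}" "1/2 \<le> \<rho>" "\<rho> < 1" "180 * l < norm (f (of_real \<rho> * cis \<theta>) - f (of_real (s * \<rho>) * cis \<theta>))"
      by auto
    obtain n where "1 / real (Suc n) < 1 - \<rho>"
      using reals_Archimedean[of "1 - \<rho>"] \<rho> by (auto simp: inverse_eq_divide)
    moreover have "1 / (real n + 2) \<le> 1 / real (Suc n)" by (simp add: frac_le)
    ultimately have "\<rho> < R n" by (simp add: R_def)
    with \<rho> have "\<rho> \<in> {1/2..<R n}" by auto
    with \<rho> have "\<theta> \<in> A n" unfolding A_def by blast
    then show "\<theta> \<in> (\<Union>n. A n)" by blast
  qed
qed

text \<open>Outside small sets, \<open>f\<close> at radius \<open>\<rho>\<close> stays uniformly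
  close to \<open>f\<close> at radius \<open>s * \<rho>\<close>, and the latter converges because
  \<open>s < 1\<close> keeps the limit point inside the disk. So the radial values are
  Cauchy.\<close>

theorem radial_limit_exists:
  fixes f :: "complex \<Rightarrow> complex"
  assumes hol: "f holomorphic_on ball 0 1" and bdd: "bounded (f ` ball 0 1)"
  shows "negligible {\<theta>\<in>{0..2*pi}. \<nexists>l. ((\<lambda>r. f (of_real r * cis \<theta>)) \<longlongrightarrow> l) (at_left 1)}"
proof -
  obtain M where "\<forall>x\<in>f ` ball 0 1. norm x \<le> M"
    using bdd by (auto simp only: bounded_iff)
  then have M: "norm (f z) \<le> M" if "norm z < 1" for z using that by auto
  define A where "A l s = {\<theta>\<in>{0..2*pi}. \<exists>\<rho>\<in>{1/2..<1}. 180 * l < norm (f (of_real \<rho> * cis \<theta>) - f (of_real (s * \<rho>) * cis \<theta>))}" for l s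
  \<comment> \<open>One good \<open>s\<close> per point and tolerance suffices, so the bad points
    are an intersection over \<open>s\<close>. As such they lie inside exceptional sets of
    arbitrarily small measure.\<close>
  define N where "N m = (\<Inter>s\<in>{1/2..<1}. A (1 / real (Suc m)) s)" for m
  have "negligible (N m)" for m
    unfolding negligible_outer_le
  proof (intro allI impI)
    fix e :: real assume "0 < e"
    have pos: "0 < 1 / real (Suc m)" by simp
    obtain s T where "1/2 \<le> s" "s < 1" "T \<in> lmeasurable" "measure lebesgue T \<le> e" "A (1 / real (Suc m)) s \<subseteq> T"
      unfolding A_def by (rule dilation_maximal[OF hol M pos \<open>0 < e\<close>])
    then show "\<exists>T. N m \<subseteq> T \<and> T \<in> lmeasurable \<and> measure lebesgue T \<le> e"
      by (intro exI[of _ T]) (auto simp: N_def)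
  qed
  then have "negligible (\<Union>m. N m)" by auto
  moreover have "{\<theta>\<in>{0..2*pi}. \<nexists>l. ((\<lambda>r. f (of_real r * cis \<theta>)) \<longlongrightarrow> l) (at_left 1)} \<subseteq> (\<Union>m. N m)"
  proof (intro subsetI, rule ccontr)
    fix \<theta> assume "\<theta> \<in> {\<theta>\<in>{0..2*pi}. \<nexists>l. ((\<lambda>r. f (of_real r * cis \<theta>)) \<longlongrightarrow> l) (at_left 1)}" and nN: "\<theta> \<notin> (\<Union>m. N m)"
    then have \<theta>: "\<theta> \<in> {0..2*pi}" and nl: "\<nexists>l. ((\<lambda>r. f (of_real r * cis \<theta>)) \<longlongrightarrow> l) (at_left 1)" by auto
    define F where "F r = f (of_real r * cis \<theta>)" for r
    have "cauchy_filter (filtermap F (at_left 1))"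
      unfolding cauchy_filter_metric_filtermap
    proof (intro allI impI)
      fix e :: real assume e: "0 < e"
      \<comment> \<open>Two dilation errors of \<open>180 * q\<close> and two continuity errors of
        \<open>100 * q\<close> will add up to \<open>560 * q\<close>, which is below
        \<open>e\<close>.\<close>
      then obtain m where m: "1 / real (Suc m) < e / 1000"
        using reals_Archimedean[of "e / 1000"] by (auto simp: inverse_eq_divide)
      define q where "q = 1 / real (Suc m)"
      have q: "0 < q" "q < e / 1000" using m by (simp_all add: q_def)
      have "\<theta> \<notin> N m" using nN by blast
      then obtain s where "s \<in> {1/2..<1}" and snA: "\<theta> \<notin> A q s"
        unfolding N_def q_def by blast
      then have s: "1/2 \<le> s" "s < 1" by auto
      have 1: "norm (F \<rho> - F (s * \<rho>)) \<le> 180 * q" if "1/2 \<le> \<rho>" "\<rho> < 1" for \<rho>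
        using snA \<theta> that unfolding A_def F_def by force
      have "isCont f (of_real (s * 1) * cis \<theta>)"
        using s holomorphic_on_imp_continuous_on[OF hol] by (auto simp: continuous_on_eq_continuous_at norm_mult)
      then have "((\<lambda>\<rho>. f (of_real (s * \<rho>) * cis \<theta>)) \<longlongrightarrow> f (of_real (s * 1) * cis \<theta>)) (at_left 1)"
        by (rule isCont_tendsto_compose) (intro tendsto_intros)
      then have "\<forall>\<^sub>F \<rho> in at_left 1. dist (F (s * \<rho>)) (F (s * 1)) < 100 * q"
        unfolding F_def by (rule tendstoD) (use q in simp)
      then have ev: "\<forall>\<^sub>F \<rho> in at_left (1::real). dist (F (s * \<rho>)) (F (s * 1)) < 100 * q \<and> \<rho> \<in> {1/2<..<1}"
        by (intro eventually_conj eventually_at_left_real) auto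
      show "\<exists>P. eventually P (at_left 1) \<and> (\<forall>x y. P x \<and> P y \<longrightarrow> dist (F x) (F y) < e)"
      proof (intro exI conjI, rule ev, intro allI impI, elim conjE)
        fix x y :: real
        assume "x \<in> {1/2<..<1}" "y \<in> {1/2<..<1}"
           and *: "dist (F (s * x)) (F (s * 1)) < 100 * q" "dist (F (s * y)) (F (s * 1)) < 100 * q"
        then have "dist (F x) (F (s * x)) \<le> 180 * q" "dist (F y) (F (s * y)) \<le> 180 * q"
          using 1 by (auto simp: dist_norm)
        with * q dist_triangle[of "F x" "F y" "F (s * x)"] dist_triangle[of "F (s * x)" "F y" "F (s * 1)"]
           dist_triangle2[of "F (s * 1)" "F y" "F (s * y)"]
        show "dist (F x) (F y) < e" by (simp add: dist_commute)
      qed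
    qed
    then obtain l where "filtermap F (at_left 1) \<le> nhds l"
      using complete_UNIV[where 'a=complex] unfolding complete_uniform
      by (metis UNIV_I filtermap_bot_iff principal_UNIV top_greatest trivial_limit_at_left_real)
    then show False using nl unfolding F_def filterlim_def by blast
  qed
  ultimately show ?thesis by (rule negligible_subset)
qed

section \<open>Blaschke products\<close>

text \<open>Absorbs the convention for a zero at the origin into a unimodular constant, so that
  later arguments need no case split.\<close>

lemma blaschke_factor_form:
  obtains k where "norm k = 1" "\<And>z. blaschke_factor c z = k * ((c - z) / (1 - cnj c * z))"
  by (rule that[of "if c = 0 then -1 else of_real (norm c) / c"])
     (auto simp: blaschke_factor_def norm_divide)

lemma norm_blaschke_denominator_ge: "norm (1 - cnj c * z) \<ge> 1 - norm c * norm z"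
  using norm_triangle_ineq2[of 1 "cnj c * z"] by (simp add: norm_mult)

lemma blaschke_denominator_nz:
  assumes "norm c < 1" "norm z \<le> 1"
  shows "1 - cnj c * z \<noteq> 0"
proof -
  have "norm c * norm z < 1" using assms mult_left_le[of "norm z" "norm c"] by simp
  then show ?thesis using norm_blaschke_denominator_ge[of c z] by auto
qed

text \<open>Its right-hand side is nonnegative in the closed disk and 0 on the circle: this gives
  both modulus statements about a Blaschke factor.\<close>

lemma blaschke_norm_identity:
  "(norm (1 - cnj c * z))\<^sup>2 - (norm (c - z))\<^sup>2 = (1 - (norm c)\<^sup>2) * (1 - (norm z)\<^sup>2)"
  unfolding cmod_power2 by (simp add: power2_eq_square algebra_simps)

lemma norm_blaschke_factor: "norm (blaschke_factor c z) = norm (c - z) / norm (1 - cnj c * z)"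
  by (rule blaschke_factor_form[of c]) (simp add: norm_mult norm_divide)

lemma norm_blaschke_factor_le_1:
  assumes "norm c < 1" "norm z \<le> 1"
  shows "norm (blaschke_factor c z) \<le> 1"
proof -
  have "0 \<le> (1 - (norm c)\<^sup>2) * (1 - (norm z)\<^sup>2)"
    using assms by (intro mult_nonneg_nonneg) (auto simp: power_le_one)
  then have "(norm (c - z))\<^sup>2 \<le> (norm (1 - cnj c * z))\<^sup>2"
    using blaschke_norm_identity[of c z] by linarith
  then have "norm (c - z) \<le> norm (1 - cnj c * z)"
    by (rule power2_le_imp_le) simp
  then show ?thesis by (simp add: norm_blaschke_factor divide_le_eq_1)
qed

lemma norm_blaschke_factor_circle:
  assumes "norm c < 1" "norm z = 1"
  shows "norm (blaschke_factor c z) = 1"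
proof -
  have "(norm (c - z))\<^sup>2 = (norm (1 - cnj c * z))\<^sup>2"
    using blaschke_norm_identity[of c z] assms by simp
  then have "norm (c - z) = norm (1 - cnj c * z)"
    by (rule power2_eq_imp_eq) auto
  then show ?thesis using blaschke_denominator_nz[of c z] assms by (simp add: norm_blaschke_factor)
qed

lemma blaschke_factor_eq_0_iff:
  assumes "norm c < 1" "norm z \<le> 1"
  shows "blaschke_factor c z = 0 \<longleftrightarrow> z = c"
  using blaschke_denominator_nz[OF assms] norm_blaschke_factor[of c z] by (metis div_by_1 divide_eq_0_iff norm_eq_zero right_minus_eq)

lemma holomorphic_blaschke_factor:
  assumes "norm c < 1"
  shows "blaschke_factor c holomorphic_on ball 0 1"
proof -
  obtain k where k: "\<And>z. blaschke_factor c z = k * ((c - z) / (1 - cnj c * z))"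
    using blaschke_factor_form[of c] by metis
  show ?thesis unfolding k[abs_def]
    using blaschke_denominator_nz[OF assms] by (intro holomorphic_intros) auto
qed

lemma continuous_blaschke_factor:
  assumes "norm c < 1"
  shows "continuous_on (cball 0 1) (blaschke_factor c)"
proof -
  obtain k where k: "\<And>z. blaschke_factor c z = k * ((c - z) / (1 - cnj c * z))"
    using blaschke_factor_form[of c] by metis
  show ?thesis unfolding k[abs_def]
    using blaschke_denominator_nz[OF assms] by (intro continuous_intros) auto
qed

text \<open>For \<open>c \<noteq> 0\<close> the difference \<open>1 - blaschke_factor c z\<close> is
  \<open>(1 - |c|) * (c + |c| * z) / (c * (1 - cnj c * z))\<close>, and
  \<open>|c + |c| * z| <= 2 * |c|\<close> removes the \<open>c\<close> in the denominator. The
  Blaschke condition thus gives absolute convergence of the product.\<close>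

lemma norm_blaschke_factor_minus_1:
  assumes c: "norm c < 1" and z: "norm z < 1"
  shows "norm (blaschke_factor c z - 1) \<le> 2 / (1 - norm z) * (1 - norm c)"
proof (cases "c = 0")
  case True
  have "norm (z - 1) \<le> 2" using norm_triangle_ineq4[of z 1] z by simp
  also have "\<dots> \<le> 2 / (1 - norm z)" using z by (simp add: field_simps)
  finally show ?thesis using True by (simp add: blaschke_factor_def)
next
  case False
  define D where "D = 1 - cnj c * z"
  have D: "D \<noteq> 0" using blaschke_denominator_nz c z by (simp add: D_def)
  have "norm c * norm z \<le> norm z" using c by (simp add: mult_left_le_one_le)
  then have nD: "1 - norm z \<le> norm D" using norm_blaschke_denominator_ge[of c z] by (simp add: D_def)
  have cc: "cnj c * c = of_real (norm c) ^ 2" by (metis complex_norm_square mult.commute of_real_power)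
  have "1 - blaschke_factor c z = (c * D - of_real (norm c) * (c - z)) / (c * D)"
  proof -
    have "blaschke_factor c z = of_real (norm c) / c * ((c - z) / D)"
      using False by (simp add: blaschke_factor_def D_def)
    then show ?thesis using False D by (simp add: field_simps)
  qed
  also have "c * D - of_real (norm c) * (c - z) = of_real (1 - norm c) * (c + of_real (norm c) * z)"
    unfolding D_def using cc by (simp add: algebra_simps power2_eq_square)
  finally have "norm (1 - blaschke_factor c z) = (1 - norm c) * norm (c + of_real (norm c) * z) / (norm c * norm D)"
    using c by (simp add: norm_divide norm_mult del: of_real_diff)
  also have "\<dots> \<le> (1 - norm c) * (norm c * 2) / (norm c * norm D)"
  proof (intro divide_right_mono mult_left_mono)
    have "norm (c + of_real (norm c) * z) \<le> norm c + norm c * norm z"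
      using norm_triangle_ineq[of c "of_real (norm c) * z"] by (simp add: norm_mult)
    also have "\<dots> \<le> norm c * 2" using z mult_left_le[of "norm z" "norm c"] by simp
    finally show "norm (c + of_real (norm c) * z) \<le> norm c * 2" .
  qed (use c in auto)
  also have "\<dots> = 2 / norm D * (1 - norm c)" using False D by (simp add: field_simps)
  also have "\<dots> \<le> 2 / (1 - norm z) * (1 - norm c)"
    using nD z c D by (intro mult_right_mono divide_left_mono mult_pos_pos) auto
  finally show ?thesis by (simp add: norm_minus_commute)
qed

text \<open>A convergent product may contain finitely many zero factors. Past them a tail is the
  quotient of the full product by a partial product, both of which approach the same nonzero
  limit.\<close>

lemma prodinf_tails_tendsto_1:
  fixes f :: "nat \<Rightarrow> 'a :: {real_normed_field}"
  assumes conv: "convergent_prod f"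
  shows "(\<lambda>n. \<Prod>i. f (i + n)) \<longlonglongrightarrow> 1"
proof -
  obtain N where N: "\<And>n. n \<ge> N \<Longrightarrow> f n \<noteq> 0"
    using convergent_prod_imp_ev_nonzero[OF conv] by (auto simp: eventually_sequentially)
  define g where "g i = f (i + N)" for i
  have g: "convergent_prod g" "\<And>i. g i \<noteq> 0"
    using conv N convergent_prod_iff_shift[of f N] by (auto simp: g_def[abs_def])
  have nz: "prodinf g \<noteq> 0" using g by (simp add: prodinf_nonzero)
  have "(\<lambda>k. \<Prod>i<k. g i) \<longlonglongrightarrow> prodinf g"
    using convergent_prod_LIMSEQ[OF g(1)] by (simp add: LIMSEQ_lessThan_iff_atMost)
  then have "(\<lambda>k. prodinf g / (\<Prod>i<k. g i)) \<longlonglongrightarrow> prodinf g / prodinf g"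
    using nz by (intro tendsto_intros)
  moreover have "prodinf g / (\<Prod>i<k. g i) = (\<Prod>i. f (i + (k + N)))" for k
    using prodinf_divide_initial_segment[OF g(1), of k] g(2) by (simp add: g_def[abs_def] add.assoc)
  ultimately have "(\<lambda>k. \<Prod>i. f (i + (k + N))) \<longlonglongrightarrow> 1" using nz by simp
  then show ?thesis by (rule LIMSEQ_offset)
qed

section \<open>Partial products, tails and the Schwarz-Pick bound\<close>

definition partial_blaschke :: "(nat \<Rightarrow> complex) \<Rightarrow> nat \<Rightarrow> complex \<Rightarrow> complex" where
  "partial_blaschke a n z = (\<Prod>j<n. blaschke_factor (a j) z)"

text \<open>Written as the Blaschke product of the shifted zeros, so that every fact of the locale
  \<open>blaschke_zeros\<close> carries over to tails through \<open>shift\<close>.\<close>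

definition tail_blaschke :: "(nat \<Rightarrow> complex) \<Rightarrow> nat \<Rightarrow> complex \<Rightarrow> complex" where
  "tail_blaschke a n = blaschke_product (\<lambda>j. a (j + n))"

locale blaschke_zeros =
  fixes a :: "nat \<Rightarrow> complex"
  assumes in_disc: "norm (a j) < 1" and summable_defect: "summable (\<lambda>j. 1 - norm (a j))"
begin

lemma convergent: 
  assumes "norm z < 1"
  shows "convergent_prod (\<lambda>j. blaschke_factor (a j) z)"
proof -
  have "summable (\<lambda>j. norm (blaschke_factor (a j) z - 1))"
    by (rule summable_comparison_test'[OF summable_mult[OF summable_defect, of "2 / (1 - norm z)"]])
       (use norm_blaschke_factor_minus_1[OF in_disc assms] in simp)
  then show ?thesis
    by (simp add: abs_convergent_prod_conv_summable abs_convergent_prod_imp_convergent_prod)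
qed

lemma partial_tendsto:
  assumes "norm z < 1"
  shows "(\<lambda>n. partial_blaschke a n z) \<longlonglongrightarrow> blaschke_product a z"
  using convergent_prod_LIMSEQ[OF convergent[OF assms]]
  by (simp add: LIMSEQ_lessThan_iff_atMost partial_blaschke_def blaschke_product_def)

lemma holomorphic_partial: "partial_blaschke a n holomorphic_on ball 0 1"
  unfolding partial_blaschke_def[abs_def] by (intro holomorphic_intros holomorphic_blaschke_factor in_disc)

lemma continuous_partial: "continuous_on (cball 0 1) (partial_blaschke a n)"
  unfolding partial_blaschke_def[abs_def] by (intro continuous_intros continuous_blaschke_factor in_disc)

lemma norm_partial_le_1: "norm z \<le> 1 \<Longrightarrow> norm (partial_blaschke a n z) \<le> 1"
  unfolding partial_blaschke_def by (auto simp: prod_norm[symmetric] intro!: prod_le_1 norm_blaschke_factor_le_1 in_disc)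

lemma norm_partial_circle: "norm z = 1 \<Longrightarrow> norm (partial_blaschke a n z) = 1"
  unfolding partial_blaschke_def by (simp add: prod_norm[symmetric] norm_blaschke_factor_circle in_disc)

lemma partial_eq_0_iff: "norm z \<le> 1 \<Longrightarrow> partial_blaschke a n z = 0 \<longleftrightarrow> z \<in> a ` {..<n}"
  unfolding partial_blaschke_def by (auto simp: blaschke_factor_eq_0_iff in_disc)

lemma norm_product_le_1: 
  assumes "norm z < 1"
  shows "norm (blaschke_product a z) \<le> 1"
  by (rule tendsto_upperbound[OF tendsto_norm[OF partial_tendsto[OF assms]]])
     (use assms in \<open>auto intro!: always_eventually norm_partial_le_1\<close>)

lemma uniform_limit_partial:
  assumes "r < 1"
  shows "uniform_limit (cball 0 r) (partial_blaschke a) (blaschke_product a) sequentially"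
proof -
  have sub: "cball 0 r \<subseteq> (cball 0 1 :: complex set)" using assms by auto
  have "uniformly_convergent_on (cball 0 r) (\<lambda>N z. \<Prod>n<N. blaschke_factor (a n) z)"
  proof (rule uniformly_convergent_on_prod')
    show "continuous_on (cball 0 r) (blaschke_factor (a n))" for n
      using continuous_blaschke_factor[OF in_disc] sub by (rule continuous_on_subset)
    show "uniformly_convergent_on (cball 0 r) (\<lambda>N z. \<Sum>n<N. norm (blaschke_factor (a n) z - 1))"
    proof (rule Weierstrass_m_test')
      show "summable (\<lambda>n. 2 / (1 - r) * (1 - norm (a n)))"
        by (intro summable_mult summable_defect)
      fix n and z :: complex assume z: "z \<in> cball 0 r"
      then have "norm (blaschke_factor (a n) z - 1) \<le> 2 / (1 - norm z) * (1 - norm (a n))"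
        using assms by (intro norm_blaschke_factor_minus_1 in_disc) auto
      also have "\<dots> \<le> 2 / (1 - r) * (1 - norm (a n))"
        using z assms in_disc[of n] by (intro mult_right_mono divide_left_mono) auto
      finally show "norm (norm (blaschke_factor (a n) z - 1)) \<le> 2 / (1 - r) * (1 - norm (a n))" by simp
    qed
  qed auto
  then obtain l where l: "uniform_limit (cball 0 r) (partial_blaschke a) l sequentially"
    unfolding uniformly_convergent_on_def partial_blaschke_def[abs_def] by blast
  have "l z = blaschke_product a z" if "z \<in> cball 0 r" for z
    using tendsto_uniform_limitI[OF l that] partial_tendsto[of z] that assms by (auto intro: LIMSEQ_unique)
  with l show ?thesis using uniform_limit_cong'[of "cball 0 r" "partial_blaschke a" "partial_blaschke a" l] by metis
qed

lemma holomorphic_product: "blaschke_product a holomorphic_on ball 0 1"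
proof (rule holomorphic_uniform_sequence[OF open_ball holomorphic_partial])
  fix z :: complex assume z: "z \<in> ball 0 1"
  define d where "d = (1 - norm z) / 2"
  have "cball z d \<subseteq> cball 0 (norm z + d)"
  proof
    fix w assume "w \<in> cball z d"
    then show "w \<in> cball 0 (norm z + d)"
      using norm_triangle_ineq2[of w z] by (simp add: dist_norm norm_minus_commute)
  qed
  moreover have "norm z + d < 1" "0 < d" using z by (auto simp: d_def field_simps)
  ultimately show "\<exists>d>0. cball z d \<subseteq> ball 0 1 \<and> uniform_limit (cball z d) (partial_blaschke a) (blaschke_product a) sequentially"
    by (intro exI[of _ d] conjI uniform_limit_on_subset[OF uniform_limit_partial[of "norm z + d"]]) auto
qed

lemma shift: "blaschke_zeros (\<lambda>j. a (j + n))"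
  using in_disc summable_iff_shift[THEN iffD2, OF summable_defect, of n] by unfold_locales simp_all

lemma norm_tail_le_1: "norm z < 1 \<Longrightarrow> norm (tail_blaschke a n z) \<le> 1"
  unfolding tail_blaschke_def by (rule blaschke_zeros.norm_product_le_1[OF shift])

lemma holomorphic_tail: "tail_blaschke a n holomorphic_on ball 0 1"
  unfolding tail_blaschke_def by (rule blaschke_zeros.holomorphic_product[OF shift])

lemma tail_tendsto_1: "norm z < 1 \<Longrightarrow> (\<lambda>n. tail_blaschke a n z) \<longlonglongrightarrow> 1"
  unfolding tail_blaschke_def blaschke_product_def by (rule prodinf_tails_tendsto_1[OF convergent])

lemma product_split:
  assumes "norm z < 1"
  shows "blaschke_product a z = partial_blaschke a n z * tail_blaschke a n z"
proof -
  have "(\<lambda>N. partial_blaschke a (N + n) z) \<longlonglongrightarrow> blaschke_product a z"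
    by (rule LIMSEQ_ignore_initial_segment[OF partial_tendsto[OF assms]])
  moreover have "partial_blaschke a (N + n) z = partial_blaschke a n z * partial_blaschke (\<lambda>j. a (j + n)) N z" for N
    by (induction N) (simp_all add: partial_blaschke_def mult_ac)
  moreover have "(\<lambda>N. partial_blaschke a n z * partial_blaschke (\<lambda>j. a (j + n)) N z) \<longlonglongrightarrow> partial_blaschke a n z * tail_blaschke a n z"
    unfolding tail_blaschke_def by (intro tendsto_intros blaschke_zeros.partial_tendsto[OF shift assms])
  ultimately show ?thesis by (auto intro: LIMSEQ_unique)
qed

text \<open>The factors before the one with index \<open>j\<close> form a partial product and those
  after it a tail, both of modulus at most 1.\<close>

lemma norm_product_le_factor:
  assumes "norm z < 1"
  shows "norm (blaschke_product a z) \<le> norm (blaschke_factor (a j) z)"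
proof -
  have "norm (blaschke_product a z) = norm (partial_blaschke a j z) * norm (blaschke_factor (a j) z) * norm (tail_blaschke a (Suc j) z)"
    using product_split[OF assms, of "Suc j"] by (simp add: partial_blaschke_def norm_mult)
  also have "\<dots> \<le> 1 * norm (blaschke_factor (a j) z) * 1"
    using assms by (intro mult_mono norm_partial_le_1 norm_tail_le_1) auto
  finally show ?thesis by simp
qed

lemma product_zero: "blaschke_product a (a j) = 0"
  using norm_product_le_factor[OF in_disc, of j j] by (simp add: norm_blaschke_factor)

text \<open>\<open>z - a j\<close> cancels against the numerator of the factor with index
  \<open>j\<close>. Both the uniform bound on the interpolants and Schwarz-Pick at the zeros come
  from this.\<close>

lemma norm_quotient_le:
  assumes "norm z < 1" "z \<noteq> a j"
  shows "norm (blaschke_product a z / (z - a j)) \<le> 1 / norm (1 - cnj (a j) * z)"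
  using norm_product_le_factor[OF assms(1), of j] assms(2)
  by (simp add: norm_blaschke_factor norm_divide field_simps norm_minus_commute split: if_splits)

text \<open>Schwarz-Pick at a zero, obtained by letting \<open>z\<close> tend to \<open>a j\<close>
  in \<open>norm_quotient_le\<close>, where the difference quotient of \<open>B\<close>
  appears.\<close>

lemma deriv_bound: "norm (deriv (blaschke_product a) (a j)) * (1 - (norm (a j))\<^sup>2) \<le> 1"
proof -
  have nz: "1 - cnj (a j) * a j \<noteq> 0" using blaschke_denominator_nz[OF in_disc, of "a j" j] in_disc[of j] by simp
  have "(blaschke_product a has_field_derivative deriv (blaschke_product a) (a j)) (at (a j))"
    using holomorphic_derivI[OF holomorphic_product open_ball] in_disc by simp
  then have "((\<lambda>z. (blaschke_product a z - blaschke_product a (a j)) / (z - a j)) \<longlongrightarrow> deriv (blaschke_product a) (a j)) (at (a j))"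
    by (simp add: has_field_derivative_iff)
  then have "((\<lambda>z. blaschke_product a z / (z - a j)) \<longlongrightarrow> deriv (blaschke_product a) (a j)) (at (a j))"
    by (simp add: product_zero)
  moreover have "((\<lambda>z. 1 / norm (1 - cnj (a j) * z)) \<longlongrightarrow> 1 / norm (1 - cnj (a j) * a j)) (at (a j))"
    using nz by (intro tendsto_intros) auto
  moreover have "\<forall>\<^sub>F z in at (a j). norm (blaschke_product a z / (z - a j)) \<le> 1 / norm (1 - cnj (a j) * z)"
  proof -
    have "\<forall>\<^sub>F z in at (a j). z \<in> ball 0 1 - {a j}"
      using in_disc[of j] by (intro eventually_at_in_open) auto
    then show ?thesis by eventually_elim (auto intro!: norm_quotient_le)
  qed
  ultimately have "norm (deriv (blaschke_product a) (a j)) \<le> 1 / norm (1 - cnj (a j) * a j)"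
    by (intro tendsto_le[OF _ _ tendsto_norm]) auto
  moreover have "1 - cnj (a j) * a j = of_real (1 - (norm (a j))\<^sup>2)"
    unfolding of_real_diff complex_norm_square by simp
  then have "norm (1 - cnj (a j) * a j) = 1 - (norm (a j))\<^sup>2"
    using in_disc[of j] by (simp only: norm_of_real) (simp add: power_le_one)
  moreover have "0 < 1 - (norm (a j))\<^sup>2" using in_disc[of j] by (simp add: power_less_one_iff abs_square_less_1)
  ultimately show ?thesis by (simp only: pos_le_divide_eq)
qed

text \<open>In the product rule the term containing \<open>partial_blaschke a n (a j)\<close>
  vanishes. This converts residues belonging to the partial products into quantities belonging to
  \<open>B\<close>, and also detects repeated zeros.\<close>

lemma deriv_split:
  assumes "j < n"
  shows "deriv (blaschke_product a) (a j) = deriv (partial_blaschke a n) (a j) * tail_blaschke a n (a j)"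
proof -
  have "((\<lambda>z. partial_blaschke a n z * tail_blaschke a n z) has_field_derivative
     deriv (partial_blaschke a n) (a j) * tail_blaschke a n (a j) + deriv (tail_blaschke a n) (a j) * partial_blaschke a n (a j)) (at (a j))"
    using in_disc
    by (intro DERIV_mult holomorphic_derivI[OF holomorphic_partial open_ball] holomorphic_derivI[OF holomorphic_tail open_ball]) auto
  moreover have "partial_blaschke a n (a j) = 0" using assms in_disc[of j] by (simp add: partial_eq_0_iff less_imp_le)
  ultimately have "((\<lambda>z. partial_blaschke a n z * tail_blaschke a n z) has_field_derivative deriv (partial_blaschke a n) (a j) * tail_blaschke a n (a j)) (at (a j))"
    by simp
  then have "(blaschke_product a has_field_derivative deriv (partial_blaschke a n) (a j) * tail_blaschke a n (a j)) (at (a j))"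
    by (rule has_field_derivative_transform_within_open[OF _ open_ball[of 0 1]]) (use in_disc product_split in auto)
  then show ?thesis by (rule DERIV_imp_deriv)
qed
end

section \<open>Boundary values\<close>

lemma eventually_radius: "\<forall>\<^sub>F r in at_left (1::real). r \<in> {0<..<1}"
  by (rule eventually_at_left_real) simp

lemma radial_tendsto: "((\<lambda>r. of_real r * \<zeta>) \<longlongrightarrow> \<zeta>) (at_left (1::real))" for \<zeta> :: complex
proof -
  have "((\<lambda>r. of_real r * \<zeta>) \<longlongrightarrow> of_real 1 * \<zeta>) (at_left (1::real))" by (intro tendsto_intros)
  then show ?thesis by simp
qed

lemma radial_bound:
  fixes f :: "complex \<Rightarrow> complex"
  assumes M: "\<And>z. norm z < 1 \<Longrightarrow> norm (f z) \<le> M" and \<zeta>: "norm \<zeta> = 1"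
    and lim: "((\<lambda>r. f (of_real r * \<zeta>)) \<longlongrightarrow> l) (at_left 1)"
  shows "norm l \<le> M"
proof (rule tendsto_upperbound[OF tendsto_norm[OF lim]])
  show "\<forall>\<^sub>F r in at_left 1. norm (f (of_real r * \<zeta>)) \<le> M"
    using eventually_radius by eventually_elim (auto intro!: M simp: norm_mult \<zeta>)
qed auto

lemma boundary_fun_eqI:
  assumes "((\<lambda>r. f (of_real r * \<zeta>)) \<longlongrightarrow> l) (at_left 1)"
  shows "boundary_fun f \<zeta> = l"
  unfolding boundary_fun_def by (rule tendsto_Lim[OF _ assms]) simp

lemma borel_measurable_Arg2pi [measurable]: "Arg2pi \<in> borel_measurable borel"
proof -
  have "Arg2pi z = (if Im z = 0 \<and> 0 \<le> Re z then 0 else Im (Ln (- z)) + pi)" for z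
  proof (cases "Im z = 0 \<and> 0 \<le> Re z")
    case True
    then show ?thesis by (simp add: Arg2pi_eq_0 complex_is_Real_iff)
  next
    case False
    then have "Arg2pi z \<noteq> 0" by (auto simp: Arg2pi_eq_0 complex_is_Real_iff)
    then have "0 < Arg2pi z" using Arg2pi_ge_0[of z] by linarith
    then show ?thesis unfolding if_not_P[OF False] by (rule Arg2pi_Ln)
  qed
  then have "Arg2pi = (\<lambda>z. if Im z = 0 \<and> 0 \<le> Re z then 0 else Im (Ln (- z)) + pi)" by blast
  moreover have "(\<lambda>z. if Im z = 0 \<and> 0 \<le> Re z then 0 else Im (Ln (- z)) + pi) \<in> borel_measurable borel"
    by measurable
  ultimately show ?thesis by simp
qed

lemma cis_measurable: "cis \<in> uniform_measure lborel {0..<2 * pi} \<rightarrow>\<^sub>M borel"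
proof -
  have "cis \<in> borel_measurable borel"
    by (intro borel_measurable_continuous_onI continuous_intros)
  then show ?thesis by simp
qed

text \<open>\<open>P\<close> need not be measurable, so an image measure directly yields only one
  direction. For the converse the null set of angles is enlarged to a Borel set \<open>N\<close> and
  pulled back along \<open>Arg2pi\<close>, which gives a Borel set \<open>Q\<close> of full measure
  on which \<open>P\<close> holds.\<close>

lemma AE_arclength_iff:
  "(AE \<zeta> in arclength. P \<zeta>) \<longleftrightarrow> negligible {\<theta>\<in>{0..2*pi}. \<not> P (cis \<theta>)}"
proof
  assume "AE \<zeta> in arclength. P \<zeta>"
  then have "AE \<theta> in uniform_measure lborel {0..<2 * pi}. P (cis \<theta>)"
    unfolding arclength_def by (rule AE_distrD[OF cis_measurable])
  then have "AE \<theta> in lborel. \<theta> \<in> {0..<2*pi} \<longrightarrow> P (cis \<theta>)"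
    by (subst (asm) AE_uniform_measure) auto
  then have "{\<theta>. \<not> (\<theta> \<in> {0..<2*pi} \<longrightarrow> P (cis \<theta>))} \<in> null_sets lebesgue"
    by (auto simp: eventually_ae_filter null_sets_completion_iff2)
  then have "negligible {\<theta>. \<not> (\<theta> \<in> {0..<2*pi} \<longrightarrow> P (cis \<theta>))}"
    by (simp add: negligible_iff_null_sets)
  \<comment> \<open>Adding the endpoint \<open>2 * pi\<close> passes from the half-open interval of
    \<open>arclength\<close> to the closed one used for integrals.\<close>
  then have "negligible ({\<theta>. \<not> (\<theta> \<in> {0..<2*pi} \<longrightarrow> P (cis \<theta>))} \<union> {2*pi})"
    by simp
  then show "negligible {\<theta>\<in>{0..2*pi}. \<not> P (cis \<theta>)}"
    by (rule negligible_subset) auto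
next
  assume "negligible {\<theta>\<in>{0..2*pi}. \<not> P (cis \<theta>)}"
  then obtain N where N: "N \<in> null_sets lborel" "{\<theta>\<in>{0..2*pi}. \<not> P (cis \<theta>)} \<subseteq> N"
    by (auto simp: negligible_iff_null_sets null_sets_completion_iff2)
  have Nm [measurable]: "N \<in> sets borel" using N by auto
  define Q where "Q = {\<zeta>::complex. norm \<zeta> = 1 \<and> Arg2pi \<zeta> \<notin> N}"
  have Qm: "{\<zeta> \<in> space borel. \<zeta> \<in> Q} \<in> sets borel"
    unfolding Q_def mem_Collect_eq by measurable
  have "AE \<theta> in lborel. \<theta> \<notin> N" using N(1) by (rule AE_not_in)
  then have "AE \<theta> in lborel. \<theta> \<in> {0..<2*pi} \<longrightarrow> cis \<theta> \<in> Q"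
  proof eventually_elim
    case (elim \<theta>)
    have "Arg2pi (cis \<theta>) = \<theta>" if "\<theta> \<in> {0..<2*pi}"
      using that Arg2pi_unique[of 1 \<theta> "cis \<theta>"] by (simp add: cis_conv_exp)
    then show ?case using elim by (auto simp: Q_def)
  qed
  then have "AE \<theta> in uniform_measure lborel {0..<2 * pi}. cis \<theta> \<in> Q"
    by (subst AE_uniform_measure) auto
  then have "AE \<zeta> in arclength. \<zeta> \<in> Q"
    unfolding arclength_def by (subst AE_distr_iff[OF cis_measurable Qm])
  then show "AE \<zeta> in arclength. P \<zeta>"
  proof eventually_elim
    case (elim \<zeta>)
    then have "norm \<zeta> = 1" "Arg2pi \<zeta> \<notin> N" by (auto simp: Q_def)
    moreover from this have "cis (Arg2pi \<zeta>) = \<zeta>"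
      using complex_norm_eq_1_exp[of \<zeta>] by (simp add: cis_conv_exp)
    ultimately show ?case using N(2) Arg2pi_ge_0[of \<zeta>] Arg2pi_lt_2pi[of \<zeta>] by force
  qed
qed

lemma negligible_of_integral_le_0:
  fixes f :: "real \<Rightarrow> real"
  assumes int: "f integrable_on S" and nonneg: "\<And>x. x \<in> S \<Longrightarrow> 0 \<le> f x" and le: "integral S f \<le> 0"
    and S: "S \<in> sets lebesgue"
  shows "negligible {x\<in>S. f x \<noteq> 0}"
proof -
  have ai: "f absolutely_integrable_on S"
    using int nonneg by (rule nonnegative_absolutely_integrable_1)
  have "integral S f = 0" using le integral_nonneg[OF int nonneg] by simp
  then have "(LINT x|lebesgue. indicator S x *\<^sub>R f x) = 0"
    using set_lebesgue_integral_eq_integral(2)[OF ai] by (simp add: set_lebesgue_integral_def)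
  then have "AE x in lebesgue. indicator S x *\<^sub>R f x = 0"
    using ai nonneg
    by (subst (asm) integral_nonneg_eq_0_iff_AE) (auto simp: set_integrable_def indicator_def)
  then obtain Z where Z: "Z \<in> null_sets lebesgue" "{x. indicator S x *\<^sub>R f x \<noteq> 0} \<subseteq> Z"
    by (auto simp: eventually_ae_filter)
  have "{x\<in>S. f x \<noteq> 0} \<subseteq> {x. indicator S x *\<^sub>R f x \<noteq> 0}" by auto
  with Z(2) have "{x\<in>S. f x \<noteq> 0} \<subseteq> Z" by blast
  moreover have "negligible Z" using Z(1) by (simp only: negligible_iff_null_sets)
  ultimately show ?thesis by (rule negligible_subset[rotated])
qed

text \<open>For the integrands to come, Cauchy's or the residue theorem gives the same value
  \<open>I\<close> on every circle \<open>r k\<close>. The radii form a sequence to allow dominated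
  convergence, and the exceptional set \<open>N\<close> is cut out of the domain so that limits
  exist everywhere on it.\<close>

lemma radial_dominated_convergence:
  fixes H :: "complex \<Rightarrow> complex"
  assumes r: "\<And>k. r k < 1" "r \<longlonglongrightarrow> 1" and N: "negligible N"
    and I: "\<And>k. ((\<lambda>t. H (of_real (r k) * cis t)) has_integral I) {0..2*pi}"
    and bd: "\<And>k t. norm (H (of_real (r k) * cis t)) \<le> C"
    and lim: "\<And>t. t \<in> {0..2*pi} - N \<Longrightarrow> ((\<lambda>r. H (of_real r * cis t)) \<longlongrightarrow> \<eta> t) (at_left 1)"
  shows "(\<eta> has_integral I) ({0..2*pi} - N)"
proof (rule has_integral_dominated_convergence[where f="\<lambda>k t. H (of_real (r k) * cis t)" and y="\<lambda>_. I" and h="\<lambda>_. C"])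
  have spike: "(g has_integral y) ({0..2*pi} - N) \<longleftrightarrow> (g has_integral y) {0..2*pi}" for g :: "real \<Rightarrow> 'b::banach" and y
    by (rule has_integral_spike_set_eq) (auto intro: negligible_subset[OF N])
  show "((\<lambda>t. H (of_real (r k) * cis t)) has_integral I) ({0..2*pi} - N)" for k
    by (simp add: spike I)
  show "(\<lambda>_. C) integrable_on ({0..2*pi} - N)"
    unfolding integrable_on_def spike using integrable_const_ivl[of C 0 "2*pi"] by (simp add: integrable_on_def)
  have fr: "filterlim r (at_left 1) sequentially"
    using r less_imp_neq[OF r(1)] by (auto simp: filterlim_at)
  show "\<forall>t\<in>{0..2*pi} - N. (\<lambda>k. H (of_real (r k) * cis t)) \<longlonglongrightarrow> \<eta> t"
    using filterlim_compose[OF lim fr] by blast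
qed (use bd in auto)

lemma radii_exist:
  fixes \<rho> :: real
  assumes "\<rho> < 1"
  obtains r :: "nat \<Rightarrow> real" where "\<And>k. \<rho> < r k" "\<And>k. r k < 1" "r \<longlonglongrightarrow> 1"
proof
  define r where "r k = 1 - (1 - \<rho>) * (1 / real (Suc (Suc k)))" for k
  show "\<rho> < r k" for k
  proof -
    have "(1 - \<rho>) * (1 / real (Suc (Suc k))) < (1 - \<rho>) * 1" using assms by (intro mult_strict_left_mono) auto
    then show ?thesis by (simp add: r_def del: of_nat_Suc)
  qed
  show "r k < 1" for k using assms by (simp add: r_def del: of_nat_Suc)
  have "(\<lambda>k. 1 / real (Suc (Suc k))) \<longlonglongrightarrow> 0" using LIMSEQ_Suc[OF lim_1_over_n, THEN LIMSEQ_Suc] by simp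
  from tendsto_diff[OF tendsto_const[of 1] tendsto_mult[OF tendsto_const[of "1 - \<rho>"] this]]
  show "r \<longlonglongrightarrow> 1" by (simp add: r_def[abs_def])
qed

lemma Cauchy_boundary:
  fixes F :: "complex \<Rightarrow> complex"
  assumes hol: "F holomorphic_on ball 0 1" and M: "\<And>z. norm z < 1 \<Longrightarrow> norm (F z) \<le> M"
    and N: "negligible N" and lim: "\<And>t. t \<in> {0..2*pi} - N \<Longrightarrow> ((\<lambda>r. F (of_real r * cis t)) \<longlongrightarrow> \<gamma> t) (at_left 1)"
    and z: "norm z < 1"
  shows "((\<lambda>t. \<gamma> t * (cis t / (cis t - z))) has_integral 2 * pi * F z) ({0..2*pi} - N)"
proof -
  \<comment> \<open>Circles of radius above this midpoint stay at distance at least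
    \<open>q - norm z\<close> from the pole, which bounds the Cauchy kernel uniformly.\<close>
  define q where "q = (1 + norm z) / 2"
  have q: "norm z < q" "q < 1" using z by (auto simp: q_def)
  obtain r :: "nat \<Rightarrow> real" where r: "\<And>k. q < r k" "\<And>k. r k < 1" "r \<longlonglongrightarrow> 1"
    using radii_exist[OF q(2)] by blast
  have r0: "0 < r k" "norm z < r k" for k using r(1)[of k] q norm_ge_zero[of z] by linarith+
  have M0: "0 \<le> M" using M[OF z] norm_ge_zero[of "F z"] by linarith
  show ?thesis
  proof (rule radial_dominated_convergence[OF r(2,3) N, where H="\<lambda>w. F w * (w / (w - z))" and C="M * (1 / (q - norm z))"])
    fix k
    have "((\<lambda>u. F u/(u-z)) has_contour_integral (2 * of_real pi * \<i> * F z)) (circlepath 0 (r k))"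
      using r(2)[of k] r0[of k]
      by (intro Cauchy_integral_circlepath holomorphic_on_imp_continuous_on holomorphic_on_subset[OF hol]) auto
    then have "((\<lambda>t. F (of_real (r k) * cis t) / (of_real (r k) * cis t - z) * of_real (r k) * \<i> * cis t) has_integral 2 * of_real pi * \<i> * F z) {0..2*pi}"
      unfolding circlepath_def by (subst (asm) has_contour_integral_part_circlepath_iff) auto
    from has_integral_mult_right[OF this, of "-\<i>"]
    show "((\<lambda>t. F (of_real (r k) * cis t) * ((of_real (r k) * cis t) / (of_real (r k) * cis t - z))) has_integral 2 * pi * F z) {0..2*pi}"
      by (simp add: algebra_simps)
    fix t
    have n: "norm (of_real (r k) * cis t) = r k" using r0[of k] by (simp add: norm_mult)
    have "q - norm z \<le> norm (of_real (r k) * cis t - z)"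
      using norm_triangle_ineq2[of "of_real (r k) * cis t" z] n r(1)[of k] by linarith
    then have "norm ((of_real (r k) * cis t) / (of_real (r k) * cis t - z)) \<le> 1 / (q - norm z)"
      unfolding norm_divide n using q r(2)[of k] r0[of k] by (intro frac_le) auto
    then show "norm (F (of_real (r k) * cis t) * ((of_real (r k) * cis t) / (of_real (r k) * cis t - z))) \<le> M * (1 / (q - norm z))"
      unfolding norm_mult[of "F _"] using M0 M n r(2)[of k] by (intro mult_mono) auto
  next
    fix t assume t: "t \<in> {0..2*pi} - N"
    have "cis t \<noteq> z" using z by auto
    then show "((\<lambda>r. F (of_real r * cis t) * ((of_real r * cis t) / (of_real r * cis t - z))) \<longlongrightarrow> \<gamma> t * (cis t / (cis t - z))) (at_left 1)"
      by (intro tendsto_mult tendsto_divide tendsto_diff lim[OF t] radial_tendsto tendsto_const) auto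
  qed
qed

lemma has_integral_const_circle_diff:
  assumes N: "negligible N"
  shows "((\<lambda>_. c :: real) has_integral 2 * pi * c) ({0..2*pi} - N)"
proof -
  have "((\<lambda>_. c) has_integral 2 * pi * c) {0..2*pi}"
    using has_integral_const_real[of c 0 "2*pi"] by simp
  then show ?thesis
    by (subst has_integral_spike_set_eq[of _ "{0..2*pi}"]) (auto intro: negligible_subset[OF N])
qed

context blaschke_zeros
begin

text \<open>The partial product is continuous up to the circle and unimodular there, so the tail has
  the limit of \<open>B\<close> divided by it, and division by a unimodular number is multiplication
  by its conjugate.\<close>

lemma tail_radial_limit:
  assumes "((\<lambda>r. blaschke_product a (of_real r * cis t)) \<longlongrightarrow> \<beta>) (at_left 1)"
  shows "((\<lambda>r. tail_blaschke a n (of_real r * cis t)) \<longlongrightarrow> \<beta> * cnj (partial_blaschke a n (cis t))) (at_left 1)"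
proof -
  let ?P = "partial_blaschke a n"
  have P: "((\<lambda>r. ?P (of_real r * cis t)) \<longlongrightarrow> ?P (cis t)) (at_left 1)"
  proof (rule continuous_on_tendsto_compose[OF continuous_partial radial_tendsto])
    show "\<forall>\<^sub>F r in at_left 1. complex_of_real r * cis t \<in> cball 0 1"
      using eventually_radius by eventually_elim (simp add: norm_mult)
  qed auto
  have n1: "norm (?P (cis t)) = 1" by (rule norm_partial_circle) simp
  then have nz: "?P (cis t) \<noteq> 0" by auto
  have "((\<lambda>r. blaschke_product a (of_real r * cis t) / ?P (of_real r * cis t)) \<longlongrightarrow> \<beta> / ?P (cis t)) (at_left 1)"
    by (intro tendsto_divide assms P nz)
  moreover have "\<forall>\<^sub>F r in at_left 1. blaschke_product a (of_real r * cis t) / ?P (of_real r * cis t) = tail_blaschke a n (of_real r * cis t)"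
  proof -
    have "\<forall>\<^sub>F r in at_left 1. ?P (of_real r * cis t) \<noteq> 0"
      using P nz by (rule tendsto_imp_eventually_ne)
    then show ?thesis using eventually_radius
      by eventually_elim (simp add: norm_mult product_split[of _ n])
  qed
  ultimately have "((\<lambda>r. tail_blaschke a n (of_real r * cis t)) \<longlongrightarrow> \<beta> / ?P (cis t)) (at_left 1)"
    by (rule Lim_transform_eventually)
  moreover have "\<beta> / ?P (cis t) = \<beta> * cnj (?P (cis t))"
    using n1 complex_div_cnj[of \<beta> "?P (cis t)"] by simp
  ultimately show ?thesis by simp
qed

text \<open>
  The tails \<open>C\<^sub>n\<close> of the product have boundary values of modulus \<open>|B|\<close>, so \<open>|C\<^sub>n(0)|\<close> is at most the mean of
  \<open>|B| \<le> 1\<close>; but \<open>C\<^sub>n(0) \<longlonglongrightarrow> 1\<close>.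
\<close>

lemma unimodular_boundary:
  "negligible {\<theta>\<in>{0..2*pi}. \<nexists>l. norm l = 1 \<and> ((\<lambda>r. blaschke_product a (of_real r * cis \<theta>)) \<longlongrightarrow> l) (at_left 1)}"
proof -
  define N where "N = {\<theta>\<in>{0..2*pi}. \<nexists>l. ((\<lambda>r. blaschke_product a (of_real r * cis \<theta>)) \<longlongrightarrow> l) (at_left 1)}"
  have N: "negligible N"
    unfolding N_def using norm_product_le_1
    by (intro radial_limit_exists holomorphic_product) (auto simp: bounded_iff intro!: exI[of _ 1])
  define S where "S = {0..2*pi} - N"
  have S: "S \<in> sets lebesgue" unfolding S_def using N by (auto intro: negligible_imp_sets)
  define \<beta> where "\<beta> \<theta> = boundary_fun (blaschke_product a) (cis \<theta>)" for \<theta>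
  have \<beta>: "((\<lambda>r. blaschke_product a (of_real r * cis \<theta>)) \<longlongrightarrow> \<beta> \<theta>) (at_left 1)" if \<theta>: "\<theta> \<in> S" for \<theta>
  proof -
    obtain l where l: "((\<lambda>r. blaschke_product a (of_real r * cis \<theta>)) \<longlongrightarrow> l) (at_left 1)"
      using \<theta> unfolding S_def N_def by blast
    with boundary_fun_eqI[OF l] show ?thesis by (simp add: \<beta>_def)
  qed
  have nb: "norm (\<beta> \<theta>) \<le> 1" if "\<theta> \<in> S" for \<theta>
    by (rule radial_bound[OF norm_product_le_1 _ \<beta>[OF that]]) auto
  have I: "((\<lambda>t. \<beta> t * cnj (partial_blaschke a n (cis t))) has_integral 2 * pi * tail_blaschke a n 0) S" for n
    using Cauchy_boundary[OF holomorphic_tail norm_tail_le_1 N, of n "\<lambda>t. \<beta> t * cnj (partial_blaschke a n (cis t))" 0]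
      tail_radial_limit[OF \<beta>] by (simp add: S_def)
  have ib: "(\<lambda>t. norm (\<beta> t)) integrable_on S"
  proof -
    \<comment> \<open>For \<open>n = 0\<close> the partial product is empty, so the formula speaks
      about \<open>\<beta>\<close> itself.\<close>
    have "\<beta> integrable_on S" using I[of 0] by (auto simp: partial_blaschke_def)
    then have "\<beta> absolutely_integrable_on S"
      using has_integral_const_circle_diff[OF N, of 1] nb
      by (intro absolutely_integrable_integrable_bound[where g="\<lambda>_. 1"]) (auto simp: S_def)
    then show ?thesis by (simp add: absolutely_integrable_on_def)
  qed
  have "norm (2 * pi * tail_blaschke a n 0) \<le> integral S (\<lambda>t. norm (\<beta> t))" for n
    unfolding integral_unique[OF I, symmetric] using ib I[of n]
    by (intro integral_norm_bound_integral) (auto simp: norm_mult norm_partial_circle)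
  then have "norm (2 * pi * (1::complex)) \<le> integral S (\<lambda>t. norm (\<beta> t))"
    by (intro tendsto_upperbound[OF tendsto_norm[OF tendsto_mult[OF tendsto_const tail_tendsto_1[of 0]]]]) auto
  then have le: "2 * pi \<le> integral S (\<lambda>t. norm (\<beta> t))" by simp
  \<comment> \<open>The integrand \<open>1 - norm (\<beta> t)\<close> is nonnegative with integral
    at most 0, so it vanishes almost everywhere.\<close>
  have "negligible {t\<in>S. 1 - norm (\<beta> t) \<noteq> 0}"
  proof (rule negligible_of_integral_le_0[OF _ _ _ S])
    have d: "((\<lambda>t. 1 - norm (\<beta> t)) has_integral (2 * pi * 1 - integral S (\<lambda>t. norm (\<beta> t)))) S"
      using has_integral_const_circle_diff[OF N, of 1] ib unfolding S_def by (intro has_integral_diff) auto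
    then show "(\<lambda>t. 1 - norm (\<beta> t)) integrable_on S" by blast
    show "integral S (\<lambda>t. 1 - norm (\<beta> t)) \<le> 0" using d le by (simp add: integral_unique)
  qed (use nb in auto)
  then have "negligible (N \<union> {t\<in>S. 1 - norm (\<beta> t) \<noteq> 0})" using N by (rule negligible_Un[rotated])
  then show ?thesis by (rule negligible_subset) (use \<beta> in \<open>auto simp: S_def\<close>)
qed
end

section \<open>Interpolation of summable sequences\<close>

lemma norm_suminf_le:
  fixes f :: "nat \<Rightarrow> 'a::banach"
  assumes "\<And>n. norm (f n) \<le> g n" "summable g"
  shows "norm (suminf f) \<le> suminf g"
proof -
  have s: "summable (\<lambda>n. norm (f n))" by (rule summable_comparison_test'[OF assms(2)]) (simp add: assms(1))
  have "norm (suminf f) \<le> (\<Sum>n. norm (f n))" by (rule summable_norm[OF s])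
  also have "\<dots> \<le> suminf g" by (intro suminf_le assms s)
  finally show ?thesis .
qed

lemma weighted_series_H_inf:
  fixes w :: "nat \<Rightarrow> complex" and u :: "nat \<Rightarrow> complex \<Rightarrow> complex"
  assumes w: "summable (\<lambda>j. norm (w j))" and hol: "\<And>j. u j holomorphic_on ball 0 1"
    and C: "\<And>j z. norm z < 1 \<Longrightarrow> norm (u j z) \<le> C"
  shows "(\<lambda>z. \<Sum>j. w j * u j z) \<in> H_inf"
proof -
  have b: "norm (w j * u j z) \<le> norm (w j) * C" if "norm z < 1" for j z
    unfolding norm_mult by (intro mult_left_mono C that) auto
  have ul: "uniform_limit (ball 0 1) (\<lambda>n z. \<Sum>j<n. w j * u j z) (\<lambda>z. \<Sum>j. w j * u j z) sequentially"
    using w b by (intro Weierstrass_m_test[where M="\<lambda>j. norm (w j) * C"] summable_mult2) auto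
  have "(\<lambda>z. \<Sum>j. w j * u j z) holomorphic_on ball 0 1"
  proof (rule holomorphic_uniform_sequence[OF open_ball, where f="\<lambda>n z. \<Sum>j<n. w j * u j z"])
    show "\<exists>d>0. cball x d \<subseteq> ball 0 1 \<and> uniform_limit (cball x d) (\<lambda>n z. \<Sum>j<n. w j * u j z) (\<lambda>z. \<Sum>j. w j * u j z) sequentially"
      if "x \<in> ball 0 1" for x :: complex
      using open_contains_cball[of "ball (0::complex) 1"] that uniform_limit_on_subset[OF ul] by (meson open_ball)
  qed (intro holomorphic_intros hol)
  moreover have "bounded ((\<lambda>z. \<Sum>j. w j * u j z) ` ball 0 1)"
    unfolding bounded_iff
    using b w by (intro exI[of _ "\<Sum>j. norm (w j) * C"]) (auto intro!: norm_suminf_le summable_mult2)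
  ultimately show ?thesis by (simp add: H_inf_def)
qed

text \<open>Tannery's theorem exchanges limit and sum; the bound \<open>C\<close> common to all
  \<open>j\<close> is what makes absolutely summable coefficients suffice.\<close>

lemma weighted_series_radial_limit:
  fixes w v :: "nat \<Rightarrow> complex" and u :: "nat \<Rightarrow> complex \<Rightarrow> complex"
  assumes w: "summable (\<lambda>j. norm (w j))" 
    and C: "\<And>j z. norm z < 1 \<Longrightarrow> norm (u j z) \<le> C" and \<zeta>: "norm \<zeta> = 1"
    and lim: "\<And>j. ((\<lambda>r. u j (of_real r * \<zeta>)) \<longlongrightarrow> v j) (at_left 1)"
  shows "((\<lambda>r. \<Sum>j. w j * u j (of_real r * \<zeta>)) \<longlongrightarrow> (\<Sum>j. w j * v j)) (at_left 1)"
proof (rule tannery_uniform_bound[where M="\<lambda>j. norm (w j) * C"])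
  show "\<forall>\<^sub>F r in at_left 1. \<forall>j. norm (w j * u j (of_real r * \<zeta>)) \<le> norm (w j) * C"
    using eventually_radius by eventually_elim (auto simp: norm_mult \<zeta> intro!: mult_left_mono C)
qed (use lim w in \<open>auto intro!: tendsto_intros summable_mult2\<close>)

locale interpolating_zeros = blaschke_zeros +
  fixes \<delta> :: real
  assumes \<delta>_pos: "0 < \<delta>" and \<delta>_le: "\<delta> \<le> norm (deriv (blaschke_product a) (a j)) * (1 - norm (a j))"
begin

lemma deriv_nz: "deriv (blaschke_product a) (a j) \<noteq> 0"
  using \<delta>_pos \<delta>_le[of j] by auto

lemma inverse_deriv_le: "1 / norm (deriv (blaschke_product a) (a j)) \<le> (1 - norm (a j)) / \<delta>"
  using \<delta>_pos \<delta>_le[of j] deriv_nz[of j] by (simp add: field_simps)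

text \<open>Follows from \<open>1 - |a 0| <= 1 - |a 0|^2\<close> and Schwarz-Pick. It ensures that
  the interpolants obey the bound \<open>1 / \<delta>\<close> also at their own node, where their
  value is 1.\<close>

lemma \<delta>_le_1: "\<delta> \<le> 1"
proof -
  have "norm (a 0)^2 \<le> norm (a 0)" using in_disc[of 0] by (simp add: power2_eq_square mult_left_le)
  then have "norm (deriv (blaschke_product a) (a 0)) * (1 - norm (a 0)) \<le> norm (deriv (blaschke_product a) (a 0)) * (1 - norm (a 0)^2)"
    by (intro mult_left_mono) auto
  then show ?thesis using \<delta>_le[of 0] deriv_bound[of 0] by linarith
qed

text \<open>If a zero recurred, the tail after its first occurrence would vanish there, and
  \<open>deriv_split\<close> would make the derivative of \<open>B\<close> vanish, against the
  interpolation condition.\<close>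

lemma inj_zeros: "inj a"
proof (rule linorder_injI)
  fix j k :: nat assume jk: "j < k"
  show "a j \<noteq> a k"
  proof
    assume eq: "a j = a k"
    have "tail_blaschke a (Suc j) (a k) = 0"
      using blaschke_zeros.product_zero[OF shift, of "Suc j" "k - Suc j"] jk by (simp add: tail_blaschke_def)
    then have "deriv (blaschke_product a) (a j) = 0"
      using deriv_split[of j "Suc j"] eq by simp
    then show False using deriv_nz by blast
  qed
qed

text \<open>The first branch fills the removable singularity at the simple zero
  \<open>a j\<close>.\<close>

definition basic_interpolant :: "nat \<Rightarrow> complex \<Rightarrow> complex" where
  "basic_interpolant j z =
     (if z = a j then 1 else blaschke_product a z / (deriv (blaschke_product a) (a j) * (z - a j)))"

lemma holomorphic_basic_interpolant: "basic_interpolant j holomorphic_on ball 0 1"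
proof -
  have "(\<lambda>z. (if z = a j then deriv (blaschke_product a) (a j)
      else (blaschke_product a z - blaschke_product a (a j)) / (z - a j)) / deriv (blaschke_product a) (a j)) holomorphic_on ball 0 1"
    using in_disc deriv_nz
    by (intro holomorphic_intros pole_lemma holomorphic_product) (auto simp: interior_open)
  then show ?thesis
    by (rule holomorphic_transform) (auto simp: basic_interpolant_def product_zero deriv_nz)
qed

text \<open>\<open>norm_quotient_le\<close> costs \<open>1 / (1 - |a j|)\<close>, and the
  interpolation condition bounds the reciprocal derivative by \<open>(1 - |a j|) / \<delta>\<close>.
  The cancellation makes the bound independent of \<open>j\<close>.\<close>

lemma norm_basic_interpolant_le:
  assumes z: "norm z < 1"
  shows "norm (basic_interpolant j z) \<le> 1 / \<delta>"
proof (cases "z = a j")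
  case True
  then show ?thesis using \<delta>_le_1 \<delta>_pos by (simp add: basic_interpolant_def)
next
  case False
  have "norm (a j) * norm z \<le> norm (a j)" using z by (intro mult_left_le) auto
  then have d: "1 - norm (a j) \<le> norm (1 - cnj (a j) * z)" using norm_blaschke_denominator_ge[of "a j" z] by linarith
  have "norm (basic_interpolant j z) = norm (blaschke_product a z / (z - a j)) * (1 / norm (deriv (blaschke_product a) (a j)))"
    using False by (simp add: basic_interpolant_def norm_divide norm_mult)
  also have "\<dots> \<le> 1 / (1 - norm (a j)) * ((1 - norm (a j)) / \<delta>)"
  proof (intro mult_mono inverse_deriv_le)
    have "1 / norm (1 - cnj (a j) * z) \<le> 1 / (1 - norm (a j))" using d in_disc[of j] by (intro divide_left_mono mult_pos_pos) auto
    then show "norm (blaschke_product a z / (z - a j)) \<le> 1 / (1 - norm (a j))"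
      using norm_quotient_le[OF z False] by linarith
  qed (use in_disc[of j] in auto)
  also have "\<dots> = 1 / \<delta>" using in_disc[of j] by simp
  finally show ?thesis .
qed

lemma basic_interpolant_at_zero: "basic_interpolant j (a k) = (if j = k then 1 else 0)"
  using inj_zeros by (auto simp: basic_interpolant_def product_zero inj_eq)

lemma basic_interpolant_radial_limit:
  assumes \<zeta>: "norm \<zeta> = 1" and lim: "((\<lambda>r. blaschke_product a (of_real r * \<zeta>)) \<longlongrightarrow> l) (at_left 1)"
  shows "((\<lambda>r. basic_interpolant j (of_real r * \<zeta>)) \<longlongrightarrow> l / (deriv (blaschke_product a) (a j) * (\<zeta> - a j))) (at_left 1)"
proof -
  have nz: "\<zeta> \<noteq> a j" using \<zeta> in_disc[of j] by auto
  have "((\<lambda>r. blaschke_product a (of_real r * \<zeta>) / (deriv (blaschke_product a) (a j) * (of_real r * \<zeta> - a j)))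
      \<longlongrightarrow> l / (deriv (blaschke_product a) (a j) * (\<zeta> - a j))) (at_left 1)"
    using nz deriv_nz[of j] by (intro tendsto_divide lim tendsto_mult tendsto_const tendsto_diff radial_tendsto) auto
  moreover have "\<forall>\<^sub>F r in at_left 1. of_real r * \<zeta> \<noteq> a j"
    using radial_tendsto nz by (rule tendsto_imp_eventually_ne)
  then have "\<forall>\<^sub>F r in at_left 1. blaschke_product a (of_real r * \<zeta>) / (deriv (blaschke_product a) (a j) * (of_real r * \<zeta> - a j))
       = basic_interpolant j (of_real r * \<zeta>)"
    by eventually_elim (simp add: basic_interpolant_def)
  ultimately show ?thesis by (rule Lim_transform_eventually)
qed

text \<open>The numerator \<open>z\<close> makes the kernel vanish at 0, which places the series
  \<open>g\<close> built from it in \<open>H_inf_0\<close>.\<close>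

definition conjugate_kernel :: "nat \<Rightarrow> complex \<Rightarrow> complex" where
  "conjugate_kernel j z = z / (cnj (deriv (blaschke_product a) (a j)) * (1 - cnj (a j) * z))"

lemma norm_conjugate_kernel_le:
  assumes z: "norm z \<le> 1"
  shows "norm (conjugate_kernel j z) \<le> 1 / \<delta>"
proof -
  have "norm (a j) * norm z \<le> norm (a j)" using z by (intro mult_left_le) auto
  then have d: "1 - norm (a j) \<le> norm (1 - cnj (a j) * z)" using norm_blaschke_denominator_ge[of "a j" z] by linarith
  have "norm (conjugate_kernel j z) = norm z * (1 / norm (1 - cnj (a j) * z)) * (1 / norm (deriv (blaschke_product a) (a j)))"
    by (simp add: conjugate_kernel_def norm_divide norm_mult)
  also have "\<dots> \<le> 1 * (1 / (1 - norm (a j))) * ((1 - norm (a j)) / \<delta>)"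
    using d in_disc[of j] z by (intro mult_mono inverse_deriv_le divide_left_mono mult_pos_pos) auto
  also have "\<dots> = 1 / \<delta>" using in_disc[of j] by simp
  finally show ?thesis .
qed

lemma holomorphic_conjugate_kernel: "conjugate_kernel j holomorphic_on ball 0 1"
  unfolding conjugate_kernel_def[abs_def]
  using blaschke_denominator_nz[OF in_disc] deriv_nz by (intro holomorphic_intros) auto

lemma conjugate_kernel_radial_limit:
  assumes \<zeta>: "norm \<zeta> = 1"
  shows "((\<lambda>r. conjugate_kernel j (of_real r * \<zeta>)) \<longlongrightarrow> conjugate_kernel j \<zeta>) (at_left 1)"
  unfolding conjugate_kernel_def using blaschke_denominator_nz[OF in_disc, of \<zeta> j] deriv_nz[of j] \<zeta>
  by (intro tendsto_divide tendsto_mult tendsto_diff tendsto_const radial_tendsto) auto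

theorem ell1_interpolation:
  assumes w: "w \<in> ell1"
  shows "w \<in> sequence_trace (K_inf (blaschke_product a)) a"
proof -
  define f where "f z = (\<Sum>j. w j * basic_interpolant j z)" for z
  define g where "g z = (\<Sum>j. cnj (w j) * conjugate_kernel j z)" for z
  have sw: "summable (\<lambda>j. norm (w j))" using w by (simp add: ell1_def)
  then have scw: "summable (\<lambda>j. norm (cnj (w j)))" by simp
  have f: "f \<in> H_inf"
    unfolding f_def[abs_def] by (intro weighted_series_H_inf[OF sw holomorphic_basic_interpolant norm_basic_interpolant_le])
  have "g \<in> H_inf"
    unfolding g_def[abs_def]
    by (intro weighted_series_H_inf[OF scw holomorphic_conjugate_kernel, where C="1/\<delta>"] norm_conjugate_kernel_le less_imp_le)
  then have g: "g \<in> H_inf_0" by (simp add: H_inf_0_def g_def conjugate_kernel_def)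
  have "boundary_fun f \<zeta> = boundary_fun (blaschke_product a) \<zeta> * cnj (boundary_fun g \<zeta>)"
    if \<zeta>: "norm \<zeta> = 1" and l: "((\<lambda>r. blaschke_product a (of_real r * \<zeta>)) \<longlongrightarrow> l) (at_left 1)" for \<zeta> l
  proof -
    have bf: "boundary_fun f \<zeta> = (\<Sum>j. w j * (l / (deriv (blaschke_product a) (a j) * (\<zeta> - a j))))"
      unfolding f_def[abs_def]
      by (intro boundary_fun_eqI weighted_series_radial_limit[OF sw norm_basic_interpolant_le \<zeta>] basic_interpolant_radial_limit[OF \<zeta> l])
    have bg: "boundary_fun g \<zeta> = (\<Sum>j. cnj (w j) * conjugate_kernel j \<zeta>)"
      unfolding g_def[abs_def]
      by (intro boundary_fun_eqI weighted_series_radial_limit[OF scw _ \<zeta>, where C="1/\<delta>"] conjugate_kernel_radial_limit[OF \<zeta>]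
         norm_conjugate_kernel_le less_imp_le)
    have sg: "summable (\<lambda>j. cnj (w j) * conjugate_kernel j \<zeta>)"
    proof (rule summable_norm_cancel, rule summable_comparison_test'[OF summable_mult2[OF sw, of "1/\<delta>"]])
      show "norm (norm (cnj (w j) * conjugate_kernel j \<zeta>)) \<le> norm (w j) * (1 / \<delta>)" for j
        using mult_left_mono[OF norm_conjugate_kernel_le[of \<zeta> j], of "norm (w j)"] \<zeta> by (simp add: norm_mult)
    qed
    then have sg': "summable (\<lambda>j. cnj (cnj (w j) * conjugate_kernel j \<zeta>))"
      by (rule bounded_linear.summable[OF bounded_linear_cnj])
    have "boundary_fun (blaschke_product a) \<zeta> * cnj (boundary_fun g \<zeta>) = l * (\<Sum>j. cnj (cnj (w j) * conjugate_kernel j \<zeta>))"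
      unfolding bg boundary_fun_eqI[OF l] by (subst bounded_linear.suminf[OF bounded_linear_cnj sg]) simp
    also have "\<dots> = (\<Sum>j. l * cnj (cnj (w j) * conjugate_kernel j \<zeta>))"
      by (rule suminf_mult[OF sg', symmetric])
    also have "\<dots> = boundary_fun f \<zeta>"
      unfolding bf
    proof (rule suminf_cong)
      fix j
      have zz: "\<zeta> * cnj \<zeta> = 1" using \<zeta> by (simp add: complex_norm_square[symmetric])
      have nz: "\<zeta> \<noteq> a j" "\<zeta> \<noteq> 0" using \<zeta> in_disc[of j] by auto
      \<comment> \<open>Here \<open>cnj \<zeta>\<close> is the reciprocal of \<open>\<zeta>\<close>;
        this is the identity that matches the conjugated kernel with the interpolant term by
        term.\<close>
      have e: "1 - a j * cnj \<zeta> = cnj \<zeta> * (\<zeta> - a j)" using zz by (simp add: algebra_simps)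
      have "cnj \<zeta> / (1 - a j * cnj \<zeta>) = 1 / (\<zeta> - a j)" unfolding e using nz by simp
      moreover have "l * cnj (cnj (w j) * conjugate_kernel j \<zeta>) =
          l * w j / deriv (blaschke_product a) (a j) * (cnj \<zeta> / (1 - a j * cnj \<zeta>))"
        by (simp add: conjugate_kernel_def)
      ultimately show "l * cnj (cnj (w j) * conjugate_kernel j \<zeta>) = w j * (l / (deriv (blaschke_product a) (a j) * (\<zeta> - a j)))"
        by simp
    qed
    finally show ?thesis by simp
  qed note key = this
  have "AE \<zeta> in arclength. boundary_fun f \<zeta> = boundary_fun (blaschke_product a) \<zeta> * cnj (boundary_fun g \<zeta>)"
    unfolding AE_arclength_iff
    by (rule negligible_subset[OF unimodular_boundary]) (use key in \<open>auto simp del: ex_simps\<close>)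
  then have "f \<in> K_inf (blaschke_product a)"
    unfolding K_inf_def using f g by blast
  moreover have "f (a k) = w k" for k
  proof -
    have "f (a k) = (\<Sum>j. if j = k then w j else 0)"
      unfolding f_def basic_interpolant_at_zero by (intro suminf_cong) simp
    also have "\<dots> = w k" using sums_If_finite_set[of "{k}" w] by (simp add: sums_iff)
    finally show ?thesis .
  qed
  ultimately show ?thesis unfolding sequence_trace_def by blast
qed
end

section \<open>The conjugate function and its Cauchy sum\<close>

lemma H_inf_boundary:
  assumes "f \<in> H_inf"
  shows "negligible {\<theta>\<in>{0..2*pi}. \<not> ((\<lambda>r. f (of_real r * cis \<theta>)) \<longlongrightarrow> boundary_fun f (cis \<theta>)) (at_left 1)}"
proof -
  have "negligible {\<theta>\<in>{0..2*pi}. \<nexists>l. ((\<lambda>r. f (of_real r * cis \<theta>)) \<longlongrightarrow> l) (at_left 1)}"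
    using assms by (intro radial_limit_exists) (auto simp: H_inf_def)
  then show ?thesis by (rule negligible_subset) (use boundary_fun_eqI in blast)
qed

context interpolating_zeros
begin

text \<open>The residue theorem for \<open>F\<close> on circles enclosing the first \<open>n\<close>
  zeros yields the sum; the pole at \<open>1/z\<close> (when \<open>z \<noteq> 0\<close>) lies
  outside the disk. On the unit circle \<open>1 / P\<close> becomes \<open>cnj P\<close>, since the
  partial product is unimodular there.\<close>

lemma radial_integral_partial_blaschke:
  assumes hol: "f holomorphic_on ball 0 1" and M: "\<And>z. norm z < 1 \<Longrightarrow> norm (f z) \<le> M"
    and N: "negligible N" and lim: "\<And>t. t \<in> {0..2*pi} - N \<Longrightarrow> ((\<lambda>r. f (of_real r * cis t)) \<longlongrightarrow> \<gamma> t) (at_left 1)"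
    and z: "norm z < 1"
  shows "((\<lambda>t. \<gamma> t * cnj (partial_blaschke a n (cis t)) * (z * cis t / (1 - z * cis t))) has_integral
     2 * pi * (\<Sum>j<n. z * f (a j) / (deriv (partial_blaschke a n) (a j) * (1 - a j * z)))) ({0..2*pi} - N)"
proof -
  let ?P = "partial_blaschke a n"
  \<comment> \<open>The remaining factor \<open>w\<close> of the kernel is supplied by
    \<open>dw = \<i> * w dt\<close> on a circle, which is why \<open>F w * w\<close> is the
    integrand below.\<close>
  define F where "F w = f w * z / (?P w * (1 - z * w))" for w
  define R where "R = (\<Sum>j<n. z * f (a j) / (deriv ?P (a j) * (1 - a j * z)))"
  have nz: "1 - z * w \<noteq> 0" if "norm w \<le> 1" for w
    using blaschke_denominator_nz[of "cnj z" w] z that by simp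
  \<comment> \<open>All poles from the first \<open>n\<close> zeros lie inside radius
    \<open>q\<close>, so every circle of radius above \<open>q\<close> sees the same
    residues.\<close>
  obtain q where q: "0 < q" "q < 1" "\<And>j. j < n \<Longrightarrow> norm (a j) < q"
  proof -
    define m where "m = Max (insert 0 ((\<lambda>j. norm (a j)) ` {..<n}))"
    have "m < 1" unfolding m_def using in_disc by (subst Max_less_iff) auto
    moreover have "0 \<le> m" "\<And>j. j < n \<Longrightarrow> norm (a j) \<le> m" unfolding m_def by (auto intro!: Max_ge)
    ultimately show ?thesis by (intro that[of "(m + 1) / 2"]) force+
  qed
  have M0: "0 \<le> M" using M[OF z] norm_ge_zero[of "f z"] by linarith
  have "compact (cball 0 1 - ball (0::complex) q)" by (intro compact_diff) auto
  moreover have "1 \<in> cball 0 1 - ball (0::complex) q" using q by auto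
  moreover have "continuous_on (cball 0 1 - ball 0 q) (\<lambda>w. norm (?P w))"
    by (intro continuous_on_norm continuous_on_subset[OF continuous_partial]) auto
  ultimately obtain w0 where w0: "w0 \<in> cball 0 1 - ball 0 q" "\<And>w. w \<in> cball 0 1 - ball 0 q \<Longrightarrow> norm (?P w0) \<le> norm (?P w)"
    using continuous_attains_inf by (metis empty_iff)
  have Pnz: "?P w \<noteq> 0" if "q \<le> norm w" "norm w \<le> 1" for w
    using that q(3) by (force simp: partial_eq_0_iff)
  \<comment> \<open>The minimum of \<open>|P|\<close> on the closed annulus from \<open>q\<close> to
    1, positive by compactness; it bounds \<open>F\<close> on all the circles at once.\<close>
  define p where "p = norm (?P w0)"
  have p: "0 < p" using Pnz[of w0] w0(1) by (auto simp: p_def)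
  obtain r :: "nat \<Rightarrow> real" where r: "\<And>k. q < r k" "\<And>k. r k < 1" "r \<longlonglongrightarrow> 1"
    using radii_exist[OF q(2)] by blast
  have "((\<lambda>t. \<gamma> t * cnj (?P (cis t)) * (z * cis t / (1 - z * cis t))) has_integral 2 * pi * R) ({0..2*pi} - N)"
  proof (rule radial_dominated_convergence[OF r(2,3) N, where H="\<lambda>w. F w * w" and C="M * 1 / (p * (1 - norm z)) * 1"])
    fix k
    have r0: "0 < r k" using q r(1)[of k] by linarith
    have Fhol: "F holomorphic_on ball 0 1 - a ` {..<n}"
      unfolding F_def
      by (intro holomorphic_intros holomorphic_on_subset[OF hol] holomorphic_on_subset[OF holomorphic_partial])
         (use nz in \<open>auto simp: partial_eq_0_iff\<close>)
    have pim: "path_image (circlepath 0 (r k)) \<subseteq> ball 0 1 - a ` {..<n}"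
      using r(2)[of k] r(1)[of k] r0 q(3) by force
    have ci: "contour_integral (circlepath 0 (r k)) F =
        2 * pi * \<i> * (\<Sum>p\<in>a ` {..<n}. winding_number (circlepath 0 (r k)) p * residue F p)"
    proof (rule Residue_theorem[OF open_ball connected_ball _ Fhol _ _ pim])
      show "\<forall>w. w \<notin> ball 0 1 \<longrightarrow> winding_number (circlepath 0 (r k)) w = 0"
        using r(2)[of k] r0 by (auto intro!: winding_number_zero_outside[of _ "cball 0 (r k)"])
    qed auto
    have res: "residue F (a j) = z * f (a j) / (deriv ?P (a j) * (1 - a j * z))" if j: "j < n" for j
    proof (rule residue_simple'[where s="ball 0 1 - a ` ({..<n} - {j})"])
      have "ball 0 1 - a ` ({..<n} - {j}) - {a j} \<subseteq> ball 0 1 - a ` {..<n}" by auto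
      then show "F holomorphic_on ball 0 1 - a ` ({..<n} - {j}) - {a j}" by (rule holomorphic_on_subset[OF Fhol])
      show "open (ball 0 1 - a ` ({..<n} - {j}))" by (intro open_Diff finite_imp_closed) auto
      show "a j \<in> ball 0 1 - a ` ({..<n} - {j})" using in_disc inj_zeros by (auto simp: inj_eq)
      have P0: "?P (a j) = 0" using j in_disc[of j] by (simp add: partial_eq_0_iff less_imp_le)
      have dnz: "deriv ?P (a j) \<noteq> 0" using deriv_split[OF j] deriv_nz[of j] by auto
      have "(?P has_field_derivative deriv ?P (a j)) (at (a j))"
        using in_disc by (intro holomorphic_derivI[OF holomorphic_partial open_ball]) auto
      then have d: "((\<lambda>w. ?P w / (w - a j)) \<longlongrightarrow> deriv ?P (a j)) (at (a j))"
        by (simp add: has_field_derivative_iff P0)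
      have "isCont f (a j)"
        using holomorphic_on_imp_continuous_on[OF hol] in_disc[of j] by (auto simp: continuous_on_eq_continuous_at)
      then have fc: "(f \<longlongrightarrow> f (a j)) (at (a j))" by (simp add: isCont_def)
      have "((\<lambda>w. f w * z / ((?P w / (w - a j)) * (1 - z * w))) \<longlongrightarrow> f (a j) * z / (deriv ?P (a j) * (1 - z * a j))) (at (a j))"
        using nz[of "a j"] in_disc[of j] dnz
        by (intro tendsto_divide tendsto_mult fc d tendsto_const tendsto_diff tendsto_ident_at) auto
      then show "((\<lambda>w. F w * (w - a j)) \<longlongrightarrow> z * f (a j) / (deriv ?P (a j) * (1 - a j * z))) (at (a j))"
        by (simp add: F_def mult_ac)
    qed
    have "(\<Sum>p\<in>a ` {..<n}. winding_number (circlepath 0 (r k)) p * residue F p) = R"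
      unfolding R_def
    proof (subst sum.reindex, use inj_zeros in \<open>auto intro: inj_on_subset\<close>, intro sum.cong refl)
      fix j assume "j \<in> {..<n}"
      then have "norm (a j) < r k" using q(3)[of j] r(1)[of k] by auto
      then show "winding_number (circlepath 0 (r k)) (a j) * residue F (a j) = z * f (a j) / (deriv ?P (a j) * (1 - a j * z))"
        using res \<open>j \<in> {..<n}\<close> by (simp add: winding_number_circlepath)
    qed
    with ci have ci': "contour_integral (circlepath 0 (r k)) F = 2 * pi * \<i> * R" by simp
    have "F contour_integrable_on circlepath 0 (r k)"
      using pim r0 by (intro contour_integrable_continuous_circlepath holomorphic_on_imp_continuous_on holomorphic_on_subset[OF Fhol]) auto
    then have "(F has_contour_integral 2 * pi * \<i> * R) (part_circlepath 0 (r k) 0 (2*pi))"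
      using ci' by (metis circlepath_def has_contour_integral_integral)
    then have "((\<lambda>t. F (of_real (r k) * cis t) * of_real (r k) * \<i> * cis t) has_integral 2 * pi * \<i> * R) {0..2*pi}"
      by (subst (asm) has_contour_integral_part_circlepath_iff) auto
    from has_integral_mult_right[OF this, of "-\<i>"]
    show "((\<lambda>t. F (of_real (r k) * cis t) * (of_real (r k) * cis t)) has_integral 2 * pi * R) {0..2*pi}"
      by (simp add: algebra_simps)
    fix t
    define w where "w = of_real (r k) * cis t"
    have nw: "norm w = r k" using r0 by (simp add: w_def norm_mult)
    have "norm (z * w) \<le> norm z" using r(2)[of k] r0 by (simp add: norm_mult nw mult_left_le)
    then have d1: "1 - norm z \<le> norm (1 - z * w)" using norm_triangle_ineq2[of 1 "z * w"] by simp
    have d2: "p \<le> norm (?P w)" unfolding p_def using r(1,2)[of k] nw by (intro w0(2)) auto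
    have "norm (F w) = norm (f w) * norm z / (norm (?P w) * norm (1 - z * w))"
      by (simp add: F_def norm_mult norm_divide)
    also have "\<dots> \<le> M * 1 / (p * (1 - norm z))"
      using d1 d2 p z M[of w] M0 nw r(2)[of k] by (intro frac_le mult_mono mult_pos_pos mult_nonneg_nonneg) auto
    finally have "norm (F w) * norm w \<le> M * 1 / (p * (1 - norm z)) * 1"
      using nw r(2)[of k] M0 p z r0 by (intro mult_mono) auto
    then show "norm (F (of_real (r k) * cis t) * (of_real (r k) * cis t)) \<le> M * 1 / (p * (1 - norm z)) * 1"
      by (simp add: w_def norm_mult)
  next
    fix t assume t: "t \<in> {0..2*pi} - N"
    have n1: "norm (?P (cis t)) = 1" by (rule norm_partial_circle) simp
    have ev: "\<forall>\<^sub>F r in at_left 1. complex_of_real r * cis t \<in> cball 0 1"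
      using eventually_radius by eventually_elim (simp add: norm_mult)
    have P: "((\<lambda>r. ?P (of_real r * cis t)) \<longlongrightarrow> ?P (cis t)) (at_left 1)"
      by (rule continuous_on_tendsto_compose[OF continuous_partial radial_tendsto _ ev]) simp
    have "((\<lambda>r. F (of_real r * cis t) * (of_real r * cis t)) \<longlongrightarrow> \<gamma> t * z / (?P (cis t) * (1 - z * cis t)) * cis t) (at_left 1)"
      unfolding F_def using n1 nz[of "cis t"]
      by (intro tendsto_divide tendsto_mult lim[OF t] P tendsto_const tendsto_diff radial_tendsto) auto
    moreover have "\<gamma> t * z / (?P (cis t) * (1 - z * cis t)) * cis t = \<gamma> t * cnj (?P (cis t)) * (z * cis t / (1 - z * cis t))"
    proof -
      have "1 / ?P (cis t) = cnj (?P (cis t))" using n1 complex_div_cnj[of 1 "?P (cis t)"] by simp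
      moreover have "\<gamma> t * z / (?P (cis t) * (1 - z * cis t)) * cis t = \<gamma> t * (1 / ?P (cis t)) * (z * cis t / (1 - z * cis t))"
        by simp
      ultimately show ?thesis by simp
    qed
    ultimately show "((\<lambda>r. F (of_real r * cis t) * (of_real r * cis t)) \<longlongrightarrow> \<gamma> t * cnj (?P (cis t)) * (z * cis t / (1 - z * cis t))) (at_left 1)"
      by simp
  qed
  then show ?thesis by (simp add: R_def)
qed

text \<open>This is \<open>cnj (conjugate_kernel j (cnj z))\<close>; hence \<open>a j\<close>
  appears without conjugation, and the reflected function \<open>cnj (g (cnj z))\<close> is the one
  represented.\<close>

definition weight :: "complex \<Rightarrow> nat \<Rightarrow> complex" where
  "weight z j = z / (deriv (blaschke_product a) (a j) * (1 - a j * z))"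

text \<open>For fixed \<open>z\<close> the factor \<open>1 - |a j|\<close> is kept instead of being
  cancelled: the values to be summed against the weights are merely bounded, so summability must
  come from the Blaschke condition.\<close>

lemma norm_weight_le:
  assumes "norm z < 1"
  shows "norm (weight z j) \<le> (1 - norm (a j)) * (1 / (\<delta> * (1 - norm z)))"
proof -
  have "norm (a j) * norm z \<le> norm z" using in_disc[of j] by (intro mult_left_le_one_le) auto
  then have d: "1 - norm z \<le> norm (1 - a j * z)" using norm_blaschke_denominator_ge[of "cnj (a j)" z] by simp
  have "norm (weight z j) = norm z * (1 / norm (1 - a j * z)) * (1 / norm (deriv (blaschke_product a) (a j)))"
    by (simp add: weight_def norm_divide norm_mult)
  also have "\<dots> \<le> 1 * (1 / (1 - norm z)) * ((1 - norm (a j)) / \<delta>)"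
    using d assms by (intro mult_mono inverse_deriv_le divide_left_mono mult_pos_pos) auto
  finally show ?thesis by (simp add: mult.commute)
qed

lemma summable_weighted:
  assumes M: "\<And>j. norm (w j) \<le> M" and z: "norm z < 1"
  shows "norm (w j * weight z j) \<le> M * ((1 - norm (a j)) * (1 / (\<delta> * (1 - norm z))))"
    and "summable (\<lambda>j. M * ((1 - norm (a j)) * (1 / (\<delta> * (1 - norm z)))))"
proof -
  have "0 \<le> M" using M[of 0] norm_ge_zero[of "w 0"] by linarith
  then show "norm (w j * weight z j) \<le> M * ((1 - norm (a j)) * (1 / (\<delta> * (1 - norm z))))"
    unfolding norm_mult by (intro mult_mono M norm_weight_le z) auto
  show "summable (\<lambda>j. M * ((1 - norm (a j)) * (1 / (\<delta> * (1 - norm z)))))"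
    by (intro summable_mult summable_mult2 summable_defect)
qed

text \<open>By \<open>deriv_split\<close> the reciprocal derivative of a partial product at
  \<open>a j\<close> is that of \<open>B\<close> times a tail at \<open>a j\<close>. The tails are
  bounded by 1 and tend to 1, so Tannery's theorem applies.\<close>

lemma finite_interpolation_tendsto:
  assumes M: "\<And>j. norm (w j) \<le> M" and z: "norm z < 1"
  shows "(\<lambda>n. \<Sum>j<n. z * w j / (deriv (partial_blaschke a n) (a j) * (1 - a j * z))) \<longlonglongrightarrow> (\<Sum>j. w j * weight z j)"
proof -
  have e: "(\<Sum>j<n. z * w j / (deriv (partial_blaschke a n) (a j) * (1 - a j * z))) =
      (\<Sum>j. if j < n then w j * weight z j * tail_blaschke a n (a j) else 0)" for n
  proof -
    have "z * w j / (deriv (partial_blaschke a n) (a j) * (1 - a j * z)) = w j * weight z j * tail_blaschke a n (a j)"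
      if "j < n" for j
    proof -
      have "deriv (partial_blaschke a n) (a j) \<noteq> 0" "tail_blaschke a n (a j) \<noteq> 0"
        using deriv_split[OF that] deriv_nz[of j] by auto
      then show ?thesis unfolding weight_def deriv_split[OF that] by simp
    qed
    then have "(\<Sum>j<n. z * w j / (deriv (partial_blaschke a n) (a j) * (1 - a j * z))) =
       (\<Sum>j<n. w j * weight z j * tail_blaschke a n (a j))" by (intro sum.cong) auto
    then show ?thesis
      using sums_If_finite_set[of "{..<n}" "\<lambda>j. w j * weight z j * tail_blaschke a n (a j)"] by (simp add: sums_iff)
  qed
  show ?thesis unfolding e
  proof (rule tannery_uniform_bound[OF _ _ summable_weighted(2)[OF M z]])
    fix j
    have "(\<lambda>n. w j * weight z j * tail_blaschke a n (a j)) \<longlonglongrightarrow> w j * weight z j * 1"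
      by (intro tendsto_intros tail_tendsto_1 in_disc)
    moreover have "\<forall>\<^sub>F n in sequentially. w j * weight z j * tail_blaschke a n (a j) = (if j < n then w j * weight z j * tail_blaschke a n (a j) else 0)"
      using eventually_gt_at_top[of j] by eventually_elim simp
    ultimately show "(\<lambda>n. if j < n then w j * weight z j * tail_blaschke a n (a j) else 0) \<longlonglongrightarrow> w j * weight z j"
      by (simp add: Lim_transform_eventually)
  next
    have "norm (if j < n then w j * weight z j * tail_blaschke a n (a j) else 0) \<le> M * ((1 - norm (a j)) * (1 / (\<delta> * (1 - norm z))))" for j n
    proof -
      have "norm (if j < n then w j * weight z j * tail_blaschke a n (a j) else 0) \<le> norm (w j * weight z j) * 1"
        using mult_left_mono[OF norm_tail_le_1[OF in_disc[of j], of n], of "norm (w j * weight z j)"] by (simp add: norm_mult)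
      then show ?thesis using summable_weighted(1)[of w M z j, OF M z] by linarith
    qed
    then show "\<forall>\<^sub>F n in sequentially. \<forall>j. norm (if j < n then w j * weight z j * tail_blaschke a n (a j) else 0) \<le> M * ((1 - norm (a j)) * (1 / (\<delta> * (1 - norm z))))"
      by simp
  qed simp
qed

text \<open>
  Residues give the formula with \<open>B\<close> replaced by its partial products \<open>P\<^sub>n\<close>. The passage to the limit uses
  that on the circle \<open>|P\<^sub>n - B|\<^sup>2 = 2 - 2 Re C\<^sub>n\<close>, with \<open>C\<^sub>n\<close> the tail product, has mean \<open>2 - 2 Re C\<^sub>n(0) \<longlonglongrightarrow> 0\<close>.
\<close>

theorem conjugate_representation:
  assumes f: "f \<in> H_inf" and g: "g \<in> H_inf_0"
    and ae: "AE \<zeta> in arclength. boundary_fun f \<zeta> = boundary_fun (blaschke_product a) \<zeta> * cnj (boundary_fun g \<zeta>)"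
    and z: "norm z < 1"
  shows "cnj (g (cnj z)) = (\<Sum>j. f (a j) * weight z j)"
proof -
  obtain Mf where "\<forall>x\<in>f ` ball 0 1. norm x \<le> Mf" using f by (auto simp only: H_inf_def bounded_iff)
  then have Mf: "norm (f x) \<le> Mf" if "norm x < 1" for x using that by auto
  obtain Mg where "\<forall>x\<in>g ` ball 0 1. norm x \<le> Mg" using g by (auto simp only: H_inf_0_def H_inf_def bounded_iff)
  then have Mg: "norm (g x) \<le> Mg" if "norm x < 1" for x using that by auto
  have gH: "g \<in> H_inf" and g0: "g 0 = 0" using g by (auto simp: H_inf_0_def)
  have fh: "f holomorphic_on ball 0 1" and gh: "g holomorphic_on ball 0 1" using f gH by (auto simp: H_inf_def)
  define \<phi> \<gamma> \<beta> where "\<phi> t = boundary_fun f (cis t)" and "\<gamma> t = boundary_fun g (cis t)"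
    and "\<beta> t = boundary_fun (blaschke_product a) (cis t)" for t
  define N where "N = {t\<in>{0..2*pi}. \<not> ((\<lambda>r. f (of_real r * cis t)) \<longlongrightarrow> \<phi> t) (at_left 1)}
     \<union> {t\<in>{0..2*pi}. \<not> ((\<lambda>r. g (of_real r * cis t)) \<longlongrightarrow> \<gamma> t) (at_left 1)}
     \<union> {t\<in>{0..2*pi}. \<nexists>l. norm l = 1 \<and> ((\<lambda>r. blaschke_product a (of_real r * cis t)) \<longlongrightarrow> l) (at_left 1)}
     \<union> {t\<in>{0..2*pi}. \<not> \<phi> t = \<beta> t * cnj (\<gamma> t)}"
  have N: "negligible N"
    unfolding N_def \<phi>_def \<gamma>_def \<beta>_def
    by (intro negligible_Un H_inf_boundary[OF f] H_inf_boundary[OF gH] unimodular_boundary ae[unfolded AE_arclength_iff])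
  define S where "S = {0..2*pi} - N"
  have lf: "((\<lambda>r. f (of_real r * cis t)) \<longlongrightarrow> \<phi> t) (at_left 1)" if "t \<in> S" for t using that unfolding S_def N_def by blast
  have lg: "((\<lambda>r. g (of_real r * cis t)) \<longlongrightarrow> \<gamma> t) (at_left 1)" if "t \<in> S" for t using that unfolding S_def N_def by blast
  have eq: "\<phi> t = \<beta> t * cnj (\<gamma> t)" if "t \<in> S" for t using that unfolding S_def N_def by blast
  have lB: "((\<lambda>r. blaschke_product a (of_real r * cis t)) \<longlongrightarrow> \<beta> t) (at_left 1)" "norm (\<beta> t) = 1" if "t \<in> S" for t
  proof -
    have "\<exists>l. norm l = 1 \<and> ((\<lambda>r. blaschke_product a (of_real r * cis t)) \<longlongrightarrow> l) (at_left 1)"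
      using that unfolding S_def N_def by blast
    then obtain l where l: "norm l = 1" "((\<lambda>r. blaschke_product a (of_real r * cis t)) \<longlongrightarrow> l) (at_left 1)" by blast
    have "\<beta> t = l" unfolding \<beta>_def by (rule boundary_fun_eqI[OF l(2)])
    with l show "((\<lambda>r. blaschke_product a (of_real r * cis t)) \<longlongrightarrow> \<beta> t) (at_left 1)" "norm (\<beta> t) = 1" by auto
  qed
  define \<kappa> where "\<kappa> t = z * cis t / (1 - z * cis t)" for t
  \<comment> \<open>Subtracting Cauchy's formula at 0 changes the kernel
    \<open>\<zeta> / (\<zeta> - cnj z)\<close> into \<open>cnj z / (\<zeta> - cnj z)\<close>, whose
    conjugate on the circle is \<open>\<kappa>\<close>. The value is unchanged because
    \<open>g 0 = 0\<close>.\<close>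
  have I1: "((\<lambda>t. \<phi> t * cnj (\<beta> t) * \<kappa> t) has_integral 2 * pi * cnj (g (cnj z))) S"
  proof -
    have 1: "((\<lambda>t. \<gamma> t * (cis t / (cis t - cnj z))) has_integral 2 * pi * g (cnj z)) S"
      unfolding S_def using lg z by (intro Cauchy_boundary[OF gh Mg N]) (auto simp: S_def)
    have 2: "((\<lambda>t. \<gamma> t * (cis t / (cis t - 0))) has_integral 2 * pi * g 0) S"
      unfolding S_def using lg by (intro Cauchy_boundary[OF gh Mg N]) (auto simp: S_def)
    have "((\<lambda>t. cnj (\<gamma> t * (cis t / (cis t - cnj z)) - \<gamma> t * (cis t / (cis t - 0)))) has_integral cnj (2 * pi * g (cnj z) - 2 * pi * g 0)) S"
      using has_integral_linear[OF has_integral_diff[OF 1 2] bounded_linear_cnj] by (simp add: o_def)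
    moreover have "cnj (\<gamma> t * (cis t / (cis t - cnj z)) - \<gamma> t * (cis t / (cis t - 0))) = \<phi> t * cnj (\<beta> t) * \<kappa> t" if "t \<in> S" for t
    proof -
      have nz: "cis t \<noteq> cnj z"
        using z by (metis complex_mod_cnj less_irrefl norm_cis)
      have "\<beta> t * cnj (\<beta> t) = 1" using lB(2)[OF that] by (simp add: complex_norm_square[symmetric])
      then have b: "\<phi> t * cnj (\<beta> t) = cnj (\<gamma> t)" unfolding eq[OF that] by (simp add: mult.commute mult.left_commute)
      have "\<gamma> t * (cis t / (cis t - cnj z)) - \<gamma> t * (cis t / (cis t - 0)) = \<gamma> t * (cnj z / (cis t - cnj z))"
        using nz by (simp add: field_simps)
      then have "cnj (\<gamma> t * (cis t / (cis t - cnj z)) - \<gamma> t * (cis t / (cis t - 0))) = cnj (\<gamma> t) * (z / (cnj (cis t) - z))"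
        by simp
      moreover have "z / (cnj (cis t) - z) = \<kappa> t"
      proof -
        have cc: "cis t * cnj (cis t) = 1" by (simp add: complex_norm_square[symmetric])
        have "1 - z * cis t = cis t * (cnj (cis t) - z)" using cc by (simp add: algebra_simps)
        then show ?thesis by (simp add: \<kappa>_def)
      qed
      ultimately show ?thesis using b by simp
    qed
    ultimately have "((\<lambda>t. \<phi> t * cnj (\<beta> t) * \<kappa> t) has_integral cnj (2 * pi * g (cnj z) - 2 * pi * g 0)) S"
      by (subst has_integral_cong) auto
    then show ?thesis by (simp add: g0)
  qed
  define R where "R n = (\<Sum>j<n. z * f (a j) / (deriv (partial_blaschke a n) (a j) * (1 - a j * z)))" for n
  have I2: "((\<lambda>t. \<phi> t * cnj (partial_blaschke a n (cis t)) * \<kappa> t) has_integral 2 * pi * R n) S" for n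
    using radial_integral_partial_blaschke[OF fh Mf N _ z, of \<phi> n] lf by (simp add: S_def \<kappa>_def R_def)
  define K where "K = Mf / (1 - norm z)"
  have K0: "0 \<le> K" using order_trans[OF norm_ge_zero Mf[OF z]] z by (simp add: K_def)
  have \<phi>\<kappa>: "norm (\<phi> t) * norm (\<kappa> t) \<le> K" if "t \<in> S" for t
  proof -
    have "1 - norm z \<le> norm (1 - z * cis t)"
      using norm_triangle_ineq2[of 1 "z * cis t"] by (simp add: norm_mult)
    then have "norm (\<kappa> t) \<le> 1 / (1 - norm z)"
      using z by (simp add: \<kappa>_def norm_divide norm_mult frac_le)
    moreover have "norm (\<phi> t) \<le> Mf" by (rule radial_bound[OF Mf _ lf[OF that]]) auto
    ultimately have "norm (\<phi> t) * norm (\<kappa> t) \<le> Mf * (1 / (1 - norm z))"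
      using order_trans[OF norm_ge_zero, of "\<phi> t" Mf] by (intro mult_mono) auto
    then show ?thesis by (simp add: K_def)
  qed
  define d where "d n = 1 - Re (tail_blaschke a n 0)" for n
  have d0: "0 \<le> d n" for n
    using norm_tail_le_1[of 0 n] complex_Re_le_cmod[of "tail_blaschke a n 0"] by (simp add: d_def)
  have dlim: "d \<longlonglongrightarrow> 0"
    unfolding d_def[abs_def] using tendsto_diff[OF tendsto_const[of 1] tendsto_Re[OF tail_tendsto_1[of 0]]] by simp
  \<comment> \<open>\<open>x <= e/2 + x^2/(2*e)\<close> is applied to
    \<open>x = |P - \<beta>|\<close> with \<open>e\<close> left free. The mean of \<open>x^2\<close>
    is \<open>2 * d n\<close>, so the right-hand side has mean \<open>e/2 + d n / e\<close>.\<close>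
  have bound: "norm (R n - cnj (g (cnj z))) \<le> K * (e / 2 + d n / e)" if e: "0 < e" for n e
  proof -
    let ?P = "\<lambda>t. partial_blaschke a n (cis t)"
    have D: "((\<lambda>t. \<phi> t * cnj (?P t) * \<kappa> t - \<phi> t * cnj (\<beta> t) * \<kappa> t) has_integral (2 * pi * R n - 2 * pi * cnj (g (cnj z)))) S"
      by (rule has_integral_diff[OF I2 I1])
    have T: "((\<lambda>t. \<beta> t * cnj (?P t)) has_integral 2 * pi * tail_blaschke a n 0) S"
      using Cauchy_boundary[OF holomorphic_tail norm_tail_le_1 N, of n "\<lambda>t. \<beta> t * cnj (?P t)" 0]
        tail_radial_limit[OF lB(1)] by (simp add: S_def)
    have T': "((\<lambda>t. Re (\<beta> t * cnj (?P t))) has_integral 2 * pi * Re (tail_blaschke a n 0)) S"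
      using has_integral_linear[OF T bounded_linear_Re] by (simp add: o_def)
    have C: "((\<lambda>t. c) has_integral 2 * pi * c) S" for c :: real unfolding S_def by (rule has_integral_const_circle_diff[OF N])
    have G: "((\<lambda>t. K * (e / 2 + (2 - 2 * Re (\<beta> t * cnj (?P t))) / (2 * e))) has_integral
       K * (2 * pi * (e / 2) + (2 * pi * 2 - 2 * (2 * pi * Re (tail_blaschke a n 0))) / (2 * e))) S"
      by (intro has_integral_mult_right has_integral_add has_integral_divide has_integral_diff C T')
    have "norm (2 * pi * R n - 2 * pi * cnj (g (cnj z))) \<le>
       K * (2 * pi * (e / 2) + (2 * pi * 2 - 2 * (2 * pi * Re (tail_blaschke a n 0))) / (2 * e))"
      unfolding integral_unique[OF D, symmetric] integral_unique[OF G, symmetric]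
    proof (rule integral_norm_bound_integral)
      fix t assume t: "t \<in> S"
      have n1: "norm (?P t) = 1" by (rule norm_partial_circle) simp
      have sq: "(norm (?P t - \<beta> t))\<^sup>2 = 2 - 2 * Re (\<beta> t * cnj (?P t))"
      proof -
        have "(norm (?P t - \<beta> t))\<^sup>2 = (norm (?P t))\<^sup>2 + (norm (\<beta> t))\<^sup>2 - 2 * Re (\<beta> t * cnj (?P t))"
          unfolding cmod_power2 by (simp add: power2_eq_square algebra_simps)
        then show ?thesis using n1 lB(2)[OF t] by simp
      qed
      have "norm (\<phi> t * cnj (?P t) * \<kappa> t - \<phi> t * cnj (\<beta> t) * \<kappa> t) = norm (\<phi> t * \<kappa> t * cnj (?P t - \<beta> t))"
        by (simp add: algebra_simps)
      also have "\<dots> = norm (\<phi> t) * norm (\<kappa> t) * norm (?P t - \<beta> t)"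
        by (simp only: norm_mult complex_mod_cnj)
      also have "\<dots> \<le> K * (e / 2 + (norm (?P t - \<beta> t))\<^sup>2 / (2 * e))"
      proof (intro mult_mono \<phi>\<kappa>[OF t] K0)
        have "0 \<le> (norm (?P t - \<beta> t) - e)\<^sup>2" by simp
        then show "norm (?P t - \<beta> t) \<le> e / 2 + (norm (?P t - \<beta> t))\<^sup>2 / (2 * e)"
          using e by (simp add: field_simps power2_eq_square)
      qed auto
      finally show "norm (\<phi> t * cnj (?P t) * \<kappa> t - \<phi> t * cnj (\<beta> t) * \<kappa> t) \<le> K * (e / 2 + (2 - 2 * Re (\<beta> t * cnj (?P t))) / (2 * e))"
        by (simp only: sq)
    qed (use D G in blast)+
    also have "\<dots> = 2 * pi * (K * (e / 2 + d n / e))"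
      using e by (simp add: d_def field_simps)
    also have "2 * pi * R n - 2 * pi * cnj (g (cnj z)) = of_real (2 * pi) * (R n - cnj (g (cnj z)))"
      by (simp add: algebra_simps)
    finally show ?thesis by (simp only: norm_mult norm_of_real) simp
  qed
  have "R \<longlonglongrightarrow> cnj (g (cnj z))"
  proof (rule LIM_zero_cancel, rule Lim_null_comparison)
    \<comment> \<open>\<open>sqrt (d n)\<close> is the right order for balancing the two terms of
      \<open>bound\<close>; the extra \<open>1 / real (Suc n)\<close> keeps \<open>e n\<close>
      positive when \<open>d n = 0\<close>.\<close>
    define e where "e n = sqrt (d n) + 1 / real (Suc n)" for n
    have e0: "0 < e n" for n using d0[of n] by (simp add: e_def add_nonneg_pos)
    have "d n / e n \<le> e n" for n
    proof -
      have "sqrt (d n) \<le> e n" by (simp add: e_def)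
      then have "(sqrt (d n))\<^sup>2 \<le> (e n)\<^sup>2" using d0[of n] by (intro power_mono) auto
      then have "d n \<le> e n * e n" using d0[of n] by (simp add: power2_eq_square)
      then show ?thesis using e0[of n] by (simp add: divide_le_eq)
    qed
    then have "norm (R n - cnj (g (cnj z))) \<le> K * (2 * e n)" for n
      using order_trans[OF bound[OF e0[of n]] mult_left_mono[OF _ K0]] e0[of n] by (smt (verit) field_sum_of_halves)
    then show "\<forall>\<^sub>F n in sequentially. norm (R n - cnj (g (cnj z))) \<le> K * (2 * e n)" by simp
    have "e \<longlonglongrightarrow> sqrt 0 + 0"
      unfolding e_def[abs_def] by (intro tendsto_add tendsto_real_sqrt dlim LIMSEQ_Suc[OF lim_1_over_n])
    then show "(\<lambda>n. K * (2 * e n)) \<longlonglongrightarrow> 0" by (auto intro!: tendsto_eq_intros)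
  qed
  moreover have "R \<longlonglongrightarrow> (\<Sum>j. f (a j) * weight z j)"
    unfolding R_def[abs_def] by (intro finite_interpolation_tendsto[OF Mf[OF in_disc] z])
  ultimately show ?thesis by (rule LIMSEQ_unique)
qed

section \<open>Ideal spaces over increasing real zeros\<close>

theorem real_zeros_ideal:
  assumes t: "\<And>j. a j = of_real (t j)" "0 \<le> t 0" "strict_mono t" "\<And>j. t j < 1"
    and X: "ideal_sequence_space X" "X \<subseteq> sequence_trace (K_inf (blaschke_product a)) a"
  shows "X \<subseteq> ell1"
proof
  fix x assume x: "x \<in> X"
  let ?D = "\<lambda>j. deriv (blaschke_product a) (a j)"
  \<comment> \<open>Same moduli as \<open>x\<close>, with phases that cancel the phase of the
    derivative in \<open>weight\<close>; being ideal, \<open>X\<close> contains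
    \<open>y\<close>.\<close>
  define y where "y j = of_real (norm (x j)) * (?D j / of_real (norm (?D j)))" for j
  have "norm (y j) \<le> norm (x j)" for j
    using deriv_nz[of j] by (simp add: y_def norm_mult norm_divide)
  then have "y \<in> X" using X(1) x unfolding ideal_sequence_space_def by blast
  then obtain f g where f: "f \<in> H_inf" and fy: "\<And>j. f (a j) = y j" and g: "g \<in> H_inf_0"
    and ae: "AE \<zeta> in arclength. boundary_fun f \<zeta> = boundary_fun (blaschke_product a) \<zeta> * cnj (boundary_fun g \<zeta>)"
    using X(2) unfolding sequence_trace_def K_inf_def by blast
  obtain Mf where "\<forall>x\<in>f ` ball 0 1. norm x \<le> Mf" using f by (auto simp only: H_inf_def bounded_iff)
  then have Mf: "norm (y j) \<le> Mf" for j using in_disc[of j] fy[of j] by (metis imageI mem_ball_0)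
  obtain M where "\<forall>x\<in>g ` ball 0 1. norm x \<le> M" using g by (auto simp only: H_inf_0_def H_inf_def bounded_iff)
  then have M: "norm (g x) \<le> M" if "norm x < 1" for x using that by auto
  have tpos: "0 \<le> t j" for j using t(2) t(3) by (metis le_trans strict_mono_less_eq zero_le order_trans)
  \<comment> \<open>The point of evaluation is \<open>t k\<close> with \<open>k > 0\<close>, hence
    at least \<open>t 1 > 0\<close>; with \<open>k = 0\<close> it could be the origin, where all
    weights vanish.\<close>
  have bound: "t 1 * (\<Sum>j<k. norm (x j)) \<le> M" if k: "0 < k" for k
  proof -
    define z where "z = t k"
    have z: "0 \<le> z" "z < 1" "t 1 \<le> z" using tpos t k by (auto simp: z_def strict_mono_less_eq)
    have nz: "norm (complex_of_real z) < 1" using z by simp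
    define c where "c j = norm (x j) * (z / (norm (?D j) * (1 - t j * z)))" for j
    have tz: "t j * z < 1" for j using mult_strict_mono'[of "t j" 1 z 1] t(4) tpos z by simp
    have c0: "0 \<le> c j" for j using tz[of j] z by (simp add: c_def)
    have cy: "y j * weight (of_real z) j = of_real (c j)" for j
      using deriv_nz[of j] by (simp add: y_def weight_def c_def t(1))
    have "summable (\<lambda>j. y j * weight (of_real z) j)"
    proof (rule summable_norm_cancel, rule summable_comparison_test'[OF summable_weighted(2)[OF Mf nz]])
      show "norm (norm (y j * weight (of_real z) j)) \<le> Mf * ((1 - norm (a j)) * (1 / (\<delta> * (1 - norm (complex_of_real z)))))" for j
        using summable_weighted(1)[of y Mf _ j, OF Mf nz] by simp
    qed
    then have sc': "summable c" unfolding cy using summable_Re by fastforce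
    have "cnj (g (cnj (of_real z))) = (\<Sum>j. of_real (c j))"
      using conjugate_representation[OF f g ae nz] by (simp add: fy cy)
    also have "\<dots> = of_real (suminf c)" by (rule suminf_of_real[OF sc', symmetric])
    finally have "norm (cnj (g (of_real z))) = \<bar>suminf c\<bar>" by (simp only: complex_cnj_complex_of_real norm_of_real)
    then have sM: "suminf c \<le> M" using M[OF nz] by simp
    have "t 1 * norm (x j) \<le> c j" if j: "j < k" for j
    proof -
      have tj: "t j \<le> z" using j t(3) by (simp add: z_def strict_mono_less_eq)
      \<comment> \<open>Here the monotonicity of the zeros is used: \<open>t j <= t k\<close>
        replaces \<open>t j * z\<close> by the smaller \<open>(t j)^2\<close>, the form covered by
        \<open>deriv_bound\<close>. Terms with \<open>j >= k\<close> need only be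
        nonnegative.\<close>
      have "norm (?D j) * (1 - t j * z) \<le> norm (?D j) * (1 - (norm (a j))\<^sup>2)"
        using tj tpos[of j] by (intro mult_left_mono) (auto simp: t(1) power2_eq_square intro: mult_left_mono)
      then have "norm (?D j) * (1 - t j * z) \<le> 1" using deriv_bound[of j] by linarith
      moreover have "0 < norm (?D j) * (1 - t j * z)" using deriv_nz[of j] tz[of j] by simp
      ultimately have "z * 1 \<le> z * (1 / (norm (?D j) * (1 - t j * z)))"
        using z by (intro mult_left_mono) (auto simp: le_divide_eq_1)
      then have "norm (x j) * t 1 \<le> norm (x j) * (z / (norm (?D j) * (1 - t j * z)))"
        using z by (intro mult_left_mono) auto
      then show ?thesis by (simp add: c_def mult.commute)
    qed
    then have "t 1 * (\<Sum>j<k. norm (x j)) \<le> (\<Sum>j<k. c j)"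
      unfolding sum_distrib_left by (intro sum_mono) auto
    also have "\<dots> \<le> suminf c" using sc' c0 by (intro sum_le_suminf) auto
    finally show ?thesis using sM by linarith
  qed
  have t1: "0 < t 1" using t(2,3) by (metis le_less_trans strict_mono_less zero_less_one)
  have "summable (\<lambda>j. norm (x j))"
  proof (rule bounded_imp_summable)
    show "(\<Sum>j\<le>n. norm (x j)) \<le> M / t 1" for n
      using bound[of "Suc n"] t1 by (simp add: lessThan_Suc_atMost pos_le_divide_eq mult.commute del: sum.lessThan_Suc)
  qed simp
  then show "x \<in> ell1" by (simp add: ell1_def)
qed
end

theorem theorem1p3:
  fixes a :: "nat \<Rightarrow> complex"
  assumes "interpolating_blaschke a"
  shows "ell1 \<subseteq> sequence_trace (K_inf (blaschke_product a)) a \<and>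
    ((\<exists>t :: nat \<Rightarrow> real. (\<forall>j. a j = of_real (t j)) \<and> 0 \<le> t 0 \<and> strict_mono t \<and> (\<forall>j. t j < 1)) \<longrightarrow>
       (\<forall>X. ideal_sequence_space X \<longrightarrow>
          X \<subseteq> sequence_trace (K_inf (blaschke_product a)) a \<longrightarrow> X \<subseteq> ell1))"
proof -
  let ?d = "\<lambda>j. norm (deriv (blaschke_product a) (a j)) * (1 - norm (a j))"
  have a: "norm (a j) < 1" for j using assms by (auto simp: interpolating_blaschke_def image_subset_iff)
  \<comment> \<open>A real \<open>INF\<close> is a lower bound only for a family that is bounded
    below; here 0 serves.\<close>
  have "bdd_below (range ?d)"
    using a by (intro bdd_belowI[of _ 0]) (auto intro!: mult_nonneg_nonneg simp: less_imp_le)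
  then have "(INF j. ?d j) \<le> ?d j" for j by (rule cINF_lower) simp
  then interpret interpolating_zeros a "INF j. ?d j"
    using assms a by unfold_locales (auto simp: interpolating_blaschke_def)
  show ?thesis using ell1_interpolation real_zeros_ideal by blast
qed

end
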